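(* Let $\theta\in(0,1)$ be irrational, let $h:\mathbb{R}\to\mathbb{R}$ be even, smooth and exponentially decaying, and let $H(b)$, $b\in\mathbb{R}$, be the incommensurate coupled chain operators on $\ell^2(\mathbb{Z})\oplus\ell^2(\mathbb{Z})$. Then there exists a set $\Sigma\subset\mathbb{R}$ such that $\sigma(H(b))=\Sigma$ for almost all $b\in\mathbb{R}$ (with respect to Lebesgue measure).
   Context: Elements of $\ell^2(\mathbb{Z})\oplus\ell^2(\mathbb{Z})$ are written $\psi=(\psi_1,\psi_2)$, $\psi_i=(\psi_{in})_{n\in\mathbb{Z}}$, with the natural inner product. $(\Delta\phi)_n:=\phi_{n+1}-2\phi_n+\phi_{n-1}$. Exponentially decaying means $|h(\eta)|\le Ce^{-c|\eta|}$ for some $C,c>0$. For $b\in\mathbb{R}$, the incommensurate coupled chain operator is the self-adjoint operator $$(H(b)\psi)_{1n}=-(\Delta\psi_1)_n+\sum_{n'\in\mathbb{Z}}h(n-(1-\theta)n'-b)\psi_{2n'},\qquad (H(b)\psi)_{2n}=-(\Delta\psi_2)_n+\sum_{n'\in\mathbb{Z}}h((1-\theta)n+b-n')\psi_{1n'}.$$ $\sigma(\cdot)$ denotes the spectrum. *)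

theory Defs
  imports "HOL-Analysis.Analysis" "HOL-Library.Function_Algebras"
begin

text \<open>
  Elements of the direct sum of two copies of (complex) \<open>l\<^sup>2(\<int>)\<close> are pairs of bi-infinite sequences
  inside the carrier set \<open>ell2_sum\<close>. Addition and subtraction are the componentwise and pointwise
  ones of the type \<open>(int \<Rightarrow> complex) \<times> (int \<Rightarrow> complex)\<close>.
\<close>

type_synonym chain_state = "(int \<Rightarrow> complex) \<times> (int \<Rightarrow> complex)"

definition ell2 :: "(int \<Rightarrow> complex) set" where
  "ell2 = {\<phi>. (\<lambda>n. (cmod (\<phi> n))\<^sup>2) summable_on UNIV}"

definition ell2_sum :: "chain_state set" where
  "ell2_sum = ell2 \<times> ell2"

definition ell2_sum_norm :: "chain_state \<Rightarrow> real" where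
  "ell2_sum_norm \<psi> =
     sqrt ((\<Sum>\<^sub>\<infinity>n. (cmod (fst \<psi> n))\<^sup>2) + (\<Sum>\<^sub>\<infinity>n. (cmod (snd \<psi> n))\<^sup>2))"

definition cscale :: "complex \<Rightarrow> chain_state \<Rightarrow> chain_state" where
  "cscale z \<psi> = ((\<lambda>n. z * fst \<psi> n), (\<lambda>n. z * snd \<psi> n))"

definition bounded_operator :: "(chain_state \<Rightarrow> chain_state) \<Rightarrow> bool" where
  "bounded_operator T \<longleftrightarrow>
     (\<forall>\<psi>\<in>ell2_sum. T \<psi> \<in> ell2_sum) \<and>
     (\<forall>\<psi>\<in>ell2_sum. \<forall>\<phi>\<in>ell2_sum. T (\<psi> + \<phi>) = T \<psi> + T \<phi>) \<and>
     (\<forall>z. \<forall>\<psi>\<in>ell2_sum. T (cscale z \<psi>) = cscale z (T \<psi>)) \<and>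
     (\<exists>K. \<forall>\<psi>\<in>ell2_sum. ell2_sum_norm (T \<psi>) \<le> K * ell2_sum_norm \<psi>)"

text \<open>
  The resolvent set consists of those \<open>z\<close> for which \<open>T - z\<close> has a bounded two-sided inverse on
  \<open>ell2_sum\<close>. The definitions are meant for operators \<open>T\<close> mapping \<open>ell2_sum\<close> into itself; the
  values of \<open>T\<close> off that carrier are irrelevant.
\<close>

definition resolvent_set :: "(chain_state \<Rightarrow> chain_state) \<Rightarrow> complex set" where
  "resolvent_set T =
     {z. \<exists>R. bounded_operator R \<and>
          (\<forall>\<psi>\<in>ell2_sum. R (T \<psi> - cscale z \<psi>) = \<psi> \<and> T (R \<psi>) - cscale z (R \<psi>) = \<psi>)}"

definition spectrum :: "(chain_state \<Rightarrow> chain_state) \<Rightarrow> complex set" where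
  "spectrum T = - resolvent_set T"

definition discrete_laplacian :: "(int \<Rightarrow> complex) \<Rightarrow> int \<Rightarrow> complex" where
  "discrete_laplacian \<phi> n = \<phi> (n + 1) - 2 * \<phi> n + \<phi> (n - 1)"

text \<open>
  For exponentially decaying \<open>h\<close> and \<open>\<psi>\<close> in \<open>ell2_sum\<close> the two series converge absolutely, so the
  default value of \<open>infsum\<close> for non-summable families plays no role.
\<close>

definition coupled_chain ::
    "(real \<Rightarrow> real) \<Rightarrow> real \<Rightarrow> real \<Rightarrow> chain_state \<Rightarrow> chain_state" where
  "coupled_chain h \<theta> b \<psi> =
     ((\<lambda>n. - discrete_laplacian (fst \<psi>) n
            + (\<Sum>\<^sub>\<infinity>n'. complex_of_real (h (of_int n - (1 - \<theta>) * of_int n' - b)) * snd \<psi> n')),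
      (\<lambda>n. - discrete_laplacian (snd \<psi>) n
            + (\<Sum>\<^sub>\<infinity>n'. complex_of_real (h ((1 - \<theta>) * of_int n + b - of_int n')) * fst \<psi> n')))"

definition even_function :: "(real \<Rightarrow> real) \<Rightarrow> bool" where
  "even_function h \<longleftrightarrow> (\<forall>x. h (- x) = h x)"

definition smooth_function :: "(real \<Rightarrow> real) \<Rightarrow> bool" where
  "smooth_function h \<longleftrightarrow> (\<forall>k x. (deriv ^^ k) h differentiable (at x))"

definition exponentially_decaying :: "(real \<Rightarrow> real) \<Rightarrow> bool" where
  "exponentially_decaying h \<longleftrightarrow> (\<exists>C>0. \<exists>c>0. \<forall>\<eta>. \<bar>h \<eta>\<bar> \<le> C * exp (- c * \<bar>\<eta>\<bar>))"

end

theory Submission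
  imports Defs
begin

text \<open>
  The spectrum is in fact the same for every \<open>b\<close>. Translating the two chains by \<open>m\<close> and \<open>k\<close> sites
  conjugates \<open>H(b)\<close> to \<open>H(b + m - (1 - \<theta>) k)\<close>, and these offsets are dense in \<open>\<real>\<close> because \<open>1 - \<theta>\<close> is
  irrational. By exponential decay and uniform continuity of \<open>h\<close>, the Schur test shows that \<open>H(b)\<close> is
  norm continuous in \<open>b\<close>, so a point of the resolvent set of \<open>H(b)\<close> stays in the resolvent set of
  \<open>H(b'')\<close> for \<open>b''\<close> near \<open>b\<close>. Choosing \<open>b''\<close> in the orbit of an arbitrary \<open>b'\<close> gives the inclusion of
  the resolvent sets for any \<open>b\<close>, \<open>b'\<close>, hence equality by symmetry.
\<close>

section \<open>Square-summable functions and kernel operators\<close>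

text \<open>The conclusion speaks of a real set, so besides independence of \<open>b\<close> the
  spectrum has to be real. Evenness of \<open>h\<close> makes the matrix of H(b) Hermitian, which
  bounds H(b) - z from below by |Im z|, but surjectivity needs a separate argument. Invertibility is
  therefore treated as \<open>expanding_onto c S\<close>: a lower bound together with surjectivity.
  One perturbation lemma with the explicit loss from c to c - d serves twice: with a small d for
  stability in \<open>b\<close>, and with d close to c for carrying surjectivity from points far off
  the real axis to every nonreal point. The obstacle to norm continuity is that uniform closeness of
  h and its translate is not summable along an infinite row. Half of the decay rate is spent on
  making the difference small, the other half on summing it. The two chains are merged into one
  sequence over \<open>int + int\<close>, so that H(b) is a single infinite matrix.\<close>

definition l2 :: "('i \<Rightarrow> complex) set" where
  "l2 = {f. (\<lambda>i. (cmod (f i))\<^sup>2) summable_on UNIV}"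

definition l2_norm :: "('i \<Rightarrow> complex) \<Rightarrow> real" where
  "l2_norm f = sqrt (\<Sum>\<^sub>\<infinity>i. (cmod (f i))\<^sup>2)"

lemma l2_norm_nonneg [simp]: "0 \<le> l2_norm f"
  by (simp add: l2_norm_def infsum_nonneg)

lemma l2_norm_power2: "(l2_norm f)\<^sup>2 = (\<Sum>\<^sub>\<infinity>i. (cmod (f i))\<^sup>2)"
  by (simp add: l2_norm_def infsum_nonneg)

lemma L2_set_le_l2_norm:
  assumes "f \<in> l2" "finite F"
  shows "L2_set (\<lambda>i. cmod (f i)) F \<le> l2_norm f"
  unfolding L2_set_def l2_norm_def
  using assms by (intro real_sqrt_le_mono finite_sum_le_infsum) (auto simp: l2_def)

lemma sum_cmod_le_l2_norm:
  assumes "f \<in> l2" "finite F"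
  shows "(\<Sum>i\<in>F. (cmod (f i))\<^sup>2) \<le> (l2_norm f)\<^sup>2"
  unfolding l2_norm_power2
  using assms by (intro finite_sum_le_infsum) (auto simp: l2_def)

lemma cmod_le_l2_norm: "f \<in> l2 \<Longrightarrow> cmod (f i) \<le> l2_norm f"
  using L2_set_le_l2_norm[of f "{i}"] by simp

text \<open>A bound on finite sections yields membership and the norm estimate at once, so later
  estimates, such as Minkowski and the Schur test, only have to be proved for finite sums.\<close>

lemma l2_normI:
  assumes "0 \<le> c" "\<And>F. finite F \<Longrightarrow> L2_set (\<lambda>i. cmod (f i)) F \<le> c"
  shows "f \<in> l2" "l2_norm f \<le> c"
proof -
  have *: "(\<Sum>i\<in>F. (cmod (f i))\<^sup>2) \<le> c\<^sup>2" if "finite F" for F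
    using assms(2)[OF that] unfolding L2_set_def by (rule sqrt_le_D)
  show l2: "f \<in> l2"
    unfolding l2_def mem_Collect_eq
    by (intro nonneg_bdd_above_summable_on bdd_aboveI2[where M = "c\<^sup>2"]) (use * in simp_all)
  have "(\<Sum>\<^sub>\<infinity>i. (cmod (f i))\<^sup>2) \<le> c\<^sup>2"
    using l2 * by (intro infsum_le_finite_sums) (auto simp: l2_def)
  then show "l2_norm f \<le> c"
    using assms(1) by (simp add: l2_norm_def real_le_lsqrt infsum_nonneg)
qed

lemma
  assumes "f \<in> l2" "g \<in> l2"
  shows l2_add: "f + g \<in> l2" and l2_norm_triangle: "l2_norm (f + g) \<le> l2_norm f + l2_norm g"
proof -
  have "L2_set (\<lambda>i. cmod ((f + g) i)) F \<le> l2_norm f + l2_norm g" if "finite F" for F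
  proof -
    have "L2_set (\<lambda>i. cmod ((f + g) i)) F \<le> L2_set (\<lambda>i. cmod (f i) + cmod (g i)) F"
      by (intro L2_set_mono) (auto simp: norm_triangle_ineq)
    also have "\<dots> \<le> L2_set (\<lambda>i. cmod (f i)) F + L2_set (\<lambda>i. cmod (g i)) F"
      by (rule L2_set_triangle_ineq)
    finally show ?thesis
      using L2_set_le_l2_norm[OF assms(1) that] L2_set_le_l2_norm[OF assms(2) that] by linarith
  qed
  then show "f + g \<in> l2" "l2_norm (f + g) \<le> l2_norm f + l2_norm g"
    using l2_normI[of "l2_norm f + l2_norm g" "f + g"] by simp_all
qed

lemma l2_cmult: "f \<in> l2 \<Longrightarrow> (\<lambda>i. z * f i) \<in> l2"
  by (simp add: l2_def norm_mult power_mult_distrib summable_on_cmult_right)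

lemma l2_norm_cmult: "l2_norm (\<lambda>i. z * f i) = cmod z * l2_norm f"
  by (simp add: l2_norm_def norm_mult power_mult_distrib infsum_cmult_right' real_sqrt_mult)

lemma l2_norm_eq_0_iff: "f \<in> l2 \<Longrightarrow> l2_norm f = 0 \<longleftrightarrow> f = (\<lambda>_. 0)"
proof
  assume f: "f \<in> l2" "l2_norm f = 0"
  then show "f = (\<lambda>_. 0)"
    using cmod_le_l2_norm[OF f(1)] by (auto intro!: ext)
qed (simp add: l2_norm_def)

lemma l2_complete:
  assumes l2: "\<And>n. \<sigma> n \<in> l2"
    and cauchy: "\<And>e. e > 0 \<Longrightarrow> \<exists>N. \<forall>m\<ge>N. \<forall>n\<ge>N. l2_norm (\<sigma> m - \<sigma> n) < e"
  obtains f where "f \<in> l2" "(\<lambda>n. l2_norm (\<sigma> n - f)) \<longlonglongrightarrow> 0"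
proof -
  have diff: "\<sigma> m - \<sigma> n \<in> l2" for m n
    using l2_add[OF l2[of m] l2_cmult[OF l2[of n], of "-1"]] by (simp add: fun_diff_def plus_fun_def)
  have "Cauchy (\<lambda>n. \<sigma> n i)" for i
    unfolding Cauchy_def dist_norm
    using cauchy cmod_le_l2_norm[OF diff] by (metis (no_types, lifting) fun_diff_def le_less_trans)
  then have "\<exists>l. (\<lambda>n. \<sigma> n i) \<longlonglongrightarrow> l" for i
    by (simp add: Cauchy_convergent_iff convergent_def)
  then obtain f where f: "\<And>i. (\<lambda>n. \<sigma> n i) \<longlonglongrightarrow> f i"
    by metis
  \<comment> \<open>Nothing is known yet about \<open>f\<close> being in \<open>l2\<close>, so n
    tends to infinity inside finite sections, where pointwise convergence suffices.
    \<open>l2_normI\<close> then gives membership of the difference along with its bound, and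
    \<open>f\<close> is recovered from it by subtraction.\<close>
  have tail: "\<exists>N. \<forall>m\<ge>N. \<sigma> m - f \<in> l2 \<and> l2_norm (\<sigma> m - f) \<le> e" if e: "e > 0" for e
  proof -
    obtain N where N: "\<And>m n. m \<ge> N \<Longrightarrow> n \<ge> N \<Longrightarrow> l2_norm (\<sigma> m - \<sigma> n) < e"
      using cauchy[OF e] by blast
    have "L2_set (\<lambda>i. cmod ((\<sigma> m - f) i)) F \<le> e" if "m \<ge> N" "finite F" for m F
    proof (rule tendsto_upperbound)
      show "(\<lambda>n. L2_set (\<lambda>i. cmod ((\<sigma> m - \<sigma> n) i)) F) \<longlonglongrightarrow> L2_set (\<lambda>i. cmod ((\<sigma> m - f) i)) F"
        unfolding L2_set_def fun_diff_def by (intro tendsto_intros f)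
      show "\<forall>\<^sub>F n in sequentially. L2_set (\<lambda>i. cmod ((\<sigma> m - \<sigma> n) i)) F \<le> e"
        using eventually_ge_at_top[of N]
      proof eventually_elim
        case (elim n)
        with N[OF that(1) elim] L2_set_le_l2_norm[OF diff that(2), of m n] show ?case by linarith
      qed
    qed simp
    then show ?thesis
      using l2_normI[of e "\<sigma> m - f" for m] e by (intro exI[of _ N]) auto
  qed
  from tail[of 1] obtain N where "\<sigma> N - f \<in> l2" by auto
  then have "\<sigma> N + (\<lambda>i. -1 * (\<sigma> N - f) i) \<in> l2"
    by (intro l2_add l2_cmult l2)
  moreover have "\<sigma> N + (\<lambda>i. -1 * (\<sigma> N - f) i) = f"
    by (simp add: fun_eq_iff)
  ultimately have "f \<in> l2" by simp
  moreover have "(\<lambda>n. l2_norm (\<sigma> n - f)) \<longlonglongrightarrow> 0"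
  proof (rule LIMSEQ_I)
    fix r :: real assume "r > 0"
    with tail[of "r / 2"] obtain N where "\<forall>m\<ge>N. l2_norm (\<sigma> m - f) \<le> r / 2" by auto
    then show "\<exists>N. \<forall>n\<ge>N. norm (l2_norm (\<sigma> n - f) - 0) < r"
      using \<open>r > 0\<close> by (intro exI[of _ N]) force
  qed
  ultimately show thesis by (rule that)
qed

section \<open>Infinite matrices and the Schur test\<close>

definition schur_bounded :: "('i \<Rightarrow> 'j \<Rightarrow> complex) \<Rightarrow> real \<Rightarrow> bool" where
  "schur_bounded k M \<longleftrightarrow> 0 \<le> M \<and>
     (\<forall>i F. finite F \<longrightarrow> (\<Sum>j\<in>F. cmod (k i j)) \<le> M) \<and>
     (\<forall>j F. finite F \<longrightarrow> (\<Sum>i\<in>F. cmod (k i j)) \<le> M)"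

definition kernel_op :: "('i \<Rightarrow> 'j \<Rightarrow> complex) \<Rightarrow> ('j \<Rightarrow> complex) \<Rightarrow> 'i \<Rightarrow> complex" where
  "kernel_op k f i = (\<Sum>\<^sub>\<infinity>j. k i j * f j)"

lemma kernel_row_abs_summable:
  fixes k :: "'a \<Rightarrow> 'b \<Rightarrow> complex"
  assumes "schur_bounded k M" "f \<in> l2"
  shows "(\<lambda>j. cmod (k i j * f j)) summable_on UNIV"
proof (rule Infinite_Sum.abs_summable_iff_bdd_above[THEN iffD2], rule bdd_aboveI2)
  fix F :: "'b set" assume F: "F \<in> {F. F \<subseteq> UNIV \<and> finite F}"
  have "(\<Sum>j\<in>F. cmod (k i j * f j)) \<le> (\<Sum>j\<in>F. cmod (k i j) * l2_norm f)"
    using cmod_le_l2_norm[OF assms(2)] by (intro sum_mono) (auto simp: norm_mult mult_left_mono)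
  also have "\<dots> \<le> M * l2_norm f"
    using F assms(1) by (simp flip: sum_distrib_right add: schur_bounded_def mult_right_mono)
  finally show "(\<Sum>j\<in>F. cmod (k i j * f j)) \<le> M * l2_norm f" .
qed

lemma kernel_row_summable:
  assumes "schur_bounded k M" "f \<in> l2"
  shows "(\<lambda>j. k i j * f j) summable_on UNIV"
  using kernel_row_abs_summable[OF assms] by (rule Infinite_Sum.abs_summable_summable)

text \<open>Splitting |k| into two square roots and applying Cauchy-Schwarz gives one factor
  \<open>M\<close> from the row sums; exchanging the sums gives the other from the column sums. With
  both index sets finite the exchange is elementary.\<close>

lemma schur_test_finite:
  assumes k: "schur_bounded k M" and f: "f \<in> l2" and A: "finite A" and B: "finite B"
  shows "L2_set (\<lambda>i. cmod (\<Sum>j\<in>B. k i j * f j)) A \<le> M * l2_norm f"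
proof -
  have M: "0 \<le> M" using k by (simp add: schur_bounded_def)
  have row: "(cmod (\<Sum>j\<in>B. k i j * f j))\<^sup>2 \<le> M * (\<Sum>j\<in>B. cmod (k i j) * (cmod (f j))\<^sup>2)" for i
  proof -
    have "(cmod (\<Sum>j\<in>B. k i j * f j))\<^sup>2 \<le> (\<Sum>j\<in>B. sqrt (cmod (k i j)) * (sqrt (cmod (k i j)) * cmod (f j)))\<^sup>2"
    proof (rule power_mono)
      have "cmod (\<Sum>j\<in>B. k i j * f j) \<le> (\<Sum>j\<in>B. cmod (k i j * f j))" by (rule norm_sum)
      also have "\<dots> = (\<Sum>j\<in>B. sqrt (cmod (k i j)) * (sqrt (cmod (k i j)) * cmod (f j)))"
        by (simp add: norm_mult flip: mult.assoc)
      finally show "cmod (\<Sum>j\<in>B. k i j * f j) \<le> \<dots>" .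
    qed simp
    also have "\<dots> \<le> (\<Sum>j\<in>B. (sqrt (cmod (k i j)))\<^sup>2) * (\<Sum>j\<in>B. (sqrt (cmod (k i j)) * cmod (f j))\<^sup>2)"
      by (rule Cauchy_Schwarz_ineq_sum)
    also have "\<dots> = (\<Sum>j\<in>B. cmod (k i j)) * (\<Sum>j\<in>B. cmod (k i j) * (cmod (f j))\<^sup>2)"
      by (simp add: power_mult_distrib)
    also have "\<dots> \<le> M * (\<Sum>j\<in>B. cmod (k i j) * (cmod (f j))\<^sup>2)"
      using k B by (intro mult_right_mono sum_nonneg) (auto simp: schur_bounded_def)
    finally show ?thesis .
  qed
  have "(\<Sum>i\<in>A. (cmod (\<Sum>j\<in>B. k i j * f j))\<^sup>2) \<le> (\<Sum>i\<in>A. M * (\<Sum>j\<in>B. cmod (k i j) * (cmod (f j))\<^sup>2))"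
    by (intro sum_mono row)
  also have "\<dots> = M * (\<Sum>j\<in>B. (\<Sum>i\<in>A. cmod (k i j)) * (cmod (f j))\<^sup>2)"
    by (simp add: sum_distrib_right flip: sum_distrib_left) (subst sum.swap, simp)
  also have "\<dots> \<le> M * (\<Sum>j\<in>B. M * (cmod (f j))\<^sup>2)"
    using k A M by (intro mult_left_mono sum_mono mult_right_mono) (auto simp: schur_bounded_def)
  also have "\<dots> \<le> M * (M * (l2_norm f)\<^sup>2)"
    using M sum_cmod_le_l2_norm[OF f B] by (simp flip: sum_distrib_left add: mult_left_mono)
  also have "\<dots> = (M * l2_norm f)\<^sup>2" by (simp add: power2_eq_square)
  finally show ?thesis
    using M by (simp add: L2_set_def real_le_lsqrt sum_nonneg)
qed

lemma
  assumes k: "schur_bounded k M" and f: "f \<in> l2"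
  shows kernel_op_l2: "kernel_op k f \<in> l2"
    and l2_norm_kernel_op: "l2_norm (kernel_op k f) \<le> M * l2_norm f"
proof -
  have "L2_set (\<lambda>i. cmod (kernel_op k f i)) A \<le> M * l2_norm f" if A: "finite A" for A
  \<comment> \<open>\<open>A\<close> stays fixed while \<open>B\<close> exhausts the columns, so
    only the convergence of finitely many rows is used.\<close>
  proof (rule tendsto_upperbound)
    show "((\<lambda>B. L2_set (\<lambda>i. cmod (\<Sum>j\<in>B. k i j * f j)) A) \<longlongrightarrow> L2_set (\<lambda>i. cmod (kernel_op k f i)) A)
            (finite_subsets_at_top UNIV)"
      unfolding L2_set_def kernel_op_def
      by (intro tendsto_intros infsum_tendsto kernel_row_summable[OF assms])
    show "\<forall>\<^sub>F B in finite_subsets_at_top UNIV. L2_set (\<lambda>i. cmod (\<Sum>j\<in>B. k i j * f j)) A \<le> M * l2_norm f"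
      by (intro eventually_finite_subsets_at_top_weakI schur_test_finite[OF k f A])
  qed simp
  moreover have "0 \<le> M * l2_norm f" using k by (simp add: schur_bounded_def)
  ultimately show "kernel_op k f \<in> l2" "l2_norm (kernel_op k f) \<le> M * l2_norm f"
    by (auto intro: l2_normI)
qed

lemma kernel_op_add:
  assumes "schur_bounded k M" "f \<in> l2" "g \<in> l2"
  shows "kernel_op k (f + g) = kernel_op k f + kernel_op k g"
  unfolding kernel_op_def fun_eq_iff plus_fun_apply
  using kernel_row_summable[OF assms(1)] assms(2,3)
  by (simp add: distrib_left infsum_add)

lemma kernel_op_cmult: "kernel_op k (\<lambda>j. z * f j) = (\<lambda>i. z * kernel_op k f i)"
  by (simp add: kernel_op_def fun_eq_iff mult.left_commute[of _ z] infsum_cmult_right')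

lemma kernel_op_diff:
  assumes "schur_bounded k M" "schur_bounded l N" "f \<in> l2"
  shows "kernel_op (\<lambda>i j. k i j - l i j) f = kernel_op k f - kernel_op l f"
proof
  fix i
  have "(\<Sum>\<^sub>\<infinity>j. k i j * f j + - (l i j * f j)) = (\<Sum>\<^sub>\<infinity>j. k i j * f j) + (\<Sum>\<^sub>\<infinity>j. - (l i j * f j))"
    using kernel_row_summable[OF assms(1,3)] kernel_row_summable[OF assms(2,3)]
    by (intro infsum_add) (auto simp: summable_on_uminus)
  then show "kernel_op (\<lambda>i j. k i j - l i j) f i = (kernel_op k f - kernel_op l f) i"
    by (simp add: kernel_op_def infsum_uminus left_diff_distrib)
qed

section \<open>The quadratic form of a Hermitian matrix\<close>

lemma kernel_form_abs_summable:
  fixes k :: "'i \<Rightarrow> 'i \<Rightarrow> complex"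
  assumes k: "schur_bounded k M" and f: "f \<in> l2"
  shows "(\<lambda>p. cmod (case p of (i, j) \<Rightarrow> k i j * f j * cnj (f i))) summable_on UNIV \<times> UNIV"
proof (rule Infinite_Sum.abs_summable_iff_bdd_above[THEN iffD2], rule bdd_aboveI2)
  fix F :: "('i \<times> 'i) set" assume "F \<in> {F. F \<subseteq> UNIV \<times> UNIV \<and> finite F}"
  then have F: "finite F" by simp
  \<comment> \<open>Enlarging \<open>F\<close> to a square lets the full row and column sums appear.
    By the arithmetic-geometric mean inequality, half of the form is then controlled by columns and
    half by rows.\<close>
  define A where "A = fst ` F \<union> snd ` F"
  have A: "finite A" "F \<subseteq> A \<times> A" using F by (force simp: A_def)+
  have bound: "cmod (k i j * f j * cnj (f i)) \<le>
      cmod (k i j) * (cmod (f j))\<^sup>2 / 2 + cmod (k i j) * (cmod (f i))\<^sup>2 / 2"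
    for i j
  proof -
    have "cmod (f j) * cmod (f i) \<le> ((cmod (f j))\<^sup>2 + (cmod (f i))\<^sup>2) / 2"
      using sum_squares_bound[of "cmod (f j)" "cmod (f i)"] by simp
    then have "cmod (k i j) * (cmod (f j) * cmod (f i)) \<le> cmod (k i j) * (((cmod (f j))\<^sup>2 + (cmod (f i))\<^sup>2) / 2)"
      by (rule mult_left_mono) simp
    then show ?thesis by (simp add: norm_mult algebra_simps add_divide_distrib)
  qed
  have "(\<Sum>p\<in>F. cmod ((\<lambda>(i, j). k i j * f j * cnj (f i)) p))
        \<le> (\<Sum>p\<in>A \<times> A. cmod ((\<lambda>(i, j). k i j * f j * cnj (f i)) p))"
    using A by (intro sum_mono2) auto
  also have "\<dots> = (\<Sum>i\<in>A. \<Sum>j\<in>A. cmod (k i j * f j * cnj (f i)))"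
    by (simp add: sum.cartesian_product case_prod_unfold)
  also have "\<dots> \<le> (\<Sum>i\<in>A. \<Sum>j\<in>A. cmod (k i j) * (cmod (f j))\<^sup>2 / 2 + cmod (k i j) * (cmod (f i))\<^sup>2 / 2)"
    by (intro sum_mono bound)
  also have "\<dots> = (\<Sum>j\<in>A. (\<Sum>i\<in>A. cmod (k i j)) * ((cmod (f j))\<^sup>2 / 2)) +
      (\<Sum>i\<in>A. (\<Sum>j\<in>A. cmod (k i j)) * ((cmod (f i))\<^sup>2 / 2))"
    by (simp add: sum.distrib sum_distrib_right sum_divide_distrib) (subst sum.swap, simp)
  also have "\<dots> \<le> (\<Sum>j\<in>A. M * ((cmod (f j))\<^sup>2 / 2)) + (\<Sum>i\<in>A. M * ((cmod (f i))\<^sup>2 / 2))"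
    using k A(1) by (intro add_mono sum_mono mult_right_mono) (auto simp: schur_bounded_def)
  also have "\<dots> = M * (\<Sum>i\<in>A. (cmod (f i))\<^sup>2)"
    by (simp flip: sum_distrib_left sum_divide_distrib)
  also have "\<dots> \<le> M * (l2_norm f)\<^sup>2"
    using k sum_cmod_le_l2_norm[OF f A(1)] by (intro mult_left_mono) (auto simp: schur_bounded_def)
  finally show "(\<Sum>p\<in>F. cmod ((\<lambda>(i, j). k i j * f j * cnj (f i)) p)) \<le> M * (l2_norm f)\<^sup>2" .
qed

text \<open>Absolute summability allows the two sums of <Kf, f> to be swapped, and Hermitian
  symmetry turns the swapped sum into the conjugate, so the form is real. The \<open>has_sum\<close>
  shape lets it be added termwise to the expansion of a squared norm.\<close>

lemma hermitian_kernel_form: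
  assumes k: "schur_bounded k M" and herm: "\<And>i j. k j i = cnj (k i j)" and f: "f \<in> l2"
  shows "((\<lambda>i. Im (kernel_op k f i * cnj (f i))) has_sum 0) UNIV"
proof -
  note sm = Infinite_Sum.abs_summable_summable[OF kernel_form_abs_summable[OF k f]]
  have row: "(\<Sum>\<^sub>\<infinity>j. k i j * f j * cnj (f i)) = kernel_op k f i * cnj (f i)" for i
    by (simp add: kernel_op_def infsum_cmult_left')
  have "(\<lambda>i. \<Sum>\<^sub>\<infinity>j. k i j * f j * cnj (f i)) summable_on UNIV"
    using summable_on_SigmaD[OF sm] summable_on_SigmaD1[OF sm] by simp
  then have sm': "(\<lambda>i. kernel_op k f i * cnj (f i)) summable_on UNIV"
    by (simp add: row)
  define S where "S = (\<Sum>\<^sub>\<infinity>i. kernel_op k f i * cnj (f i))"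
  have "S = (\<Sum>\<^sub>\<infinity>i. \<Sum>\<^sub>\<infinity>j. k i j * f j * cnj (f i))"
    by (simp add: S_def row)
  also have "\<dots> = (\<Sum>\<^sub>\<infinity>j. \<Sum>\<^sub>\<infinity>i. k i j * f j * cnj (f i))"
    by (rule infsum_swap_banach[OF sm])
  also have "\<dots> = (\<Sum>\<^sub>\<infinity>j. \<Sum>\<^sub>\<infinity>i. cnj (k j i * f i * cnj (f j)))"
  proof (intro infsum_cong)
    fix i j
    have "cnj (k j i) = k i j" by (subst herm) simp
    then show "k i j * f j * cnj (f i) = cnj (k j i * f i * cnj (f j))"
      by (simp add: mult.commute mult.left_commute)
  qed
  also have "\<dots> = cnj S"
    unfolding infsum_cnj by (simp add: S_def row)
  finally have "Im S = 0" by (metis cnj.simps(2) equal_neg_zero)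
  moreover have "((\<lambda>i. Im (kernel_op k f i * cnj (f i))) has_sum Im S) UNIV"
    unfolding S_def by (intro has_sum_Im has_sum_infsum sm')
  ultimately show ?thesis by simp
qed

text \<open>With z = x + iy, expand the square of the norm of (K - x)f - iyf. The cross term is -2y
  Im <Kf, f>, since x contributes only a real number, and it vanishes. What remains is at least y^2
  times the square of the norm of f.\<close>

lemma hermitian_kernel_lower_bound:
  assumes k: "schur_bounded k M" and herm: "\<And>i j. k j i = cnj (k i j)" and f: "f \<in> l2"
  shows "\<bar>Im z\<bar> * l2_norm f \<le> l2_norm (\<lambda>i. kernel_op k f i - z * f i)"
proof -
  define g where "g = (\<lambda>i. kernel_op k f i - of_real (Re z) * f i)"
  have "g = kernel_op k f + (\<lambda>i. - of_real (Re z) * f i)" by (auto simp: g_def)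
  then have g: "g \<in> l2" using l2_add[OF kernel_op_l2[OF k f] l2_cmult[OF f]] by metis
  have h: "((\<lambda>i. (cmod (kernel_op k f i - z * f i))\<^sup>2) has_sum
         ((l2_norm g)\<^sup>2 + (Im z)\<^sup>2 * (l2_norm f)\<^sup>2 + - 2 * Im z * 0)) UNIV"
  proof -
    have "(cmod (kernel_op k f i - z * f i))\<^sup>2 =
        (cmod (g i))\<^sup>2 + (Im z)\<^sup>2 * (cmod (f i))\<^sup>2 + - 2 * Im z * Im (kernel_op k f i * cnj (f i))" for i
      unfolding g_def cmod_power2 by (simp add: power2_eq_square algebra_simps)
    moreover have "((\<lambda>i. (cmod (g i))\<^sup>2 + (Im z)\<^sup>2 * (cmod (f i))\<^sup>2 + - 2 * Im z * Im (kernel_op k f i * cnj (f i)))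
       has_sum ((l2_norm g)\<^sup>2 + (Im z)\<^sup>2 * (l2_norm f)\<^sup>2 + - 2 * Im z * 0)) UNIV"
      unfolding l2_norm_power2
      by (intro has_sum_add has_sum_cmult_right has_sum_infsum hermitian_kernel_form[OF k herm f])
         (use f g in \<open>auto simp: l2_def\<close>)
    ultimately show ?thesis by presburger
  qed
  then have "(l2_norm (\<lambda>i. kernel_op k f i - z * f i))\<^sup>2 = (l2_norm g)\<^sup>2 + (Im z)\<^sup>2 * (l2_norm f)\<^sup>2"
    unfolding l2_norm_power2[of "\<lambda>i. kernel_op k f i - z * f i"] using infsumI[OF h] by simp
  then have "(\<bar>Im z\<bar> * l2_norm f)\<^sup>2 \<le> (l2_norm (\<lambda>i. kernel_op k f i - z * f i))\<^sup>2"
    by (simp add: power_mult_distrib)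
  then show ?thesis by (rule power2_le_imp_le) simp
qed

section \<open>Expanding maps of the state space and the resolvent set\<close>

text \<open>Identifies the direct sum with \<open>l2\<close> over \<open>int + int\<close>,
  isometrically by \<open>ell2_sum_norm_eq\<close>, so that the matrix estimates apply to a
  two-component state without treating components separately.\<close>

definition flatten :: "chain_state \<Rightarrow> int + int \<Rightarrow> complex" where
  "flatten \<psi> = case_sum (fst \<psi>) (snd \<psi>)"

definition unflatten :: "(int + int \<Rightarrow> complex) \<Rightarrow> chain_state" where
  "unflatten f = (f \<circ> Inl, f \<circ> Inr)"

lemma flatten_simps [simp]:
  "flatten \<psi> (Inl n) = fst \<psi> n" "flatten \<psi> (Inr n) = snd \<psi> n"
  by (simp_all add: flatten_def)

lemma flatten_unflatten [simp]: "flatten (unflatten f) = f"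
  by (auto simp: fun_eq_iff unflatten_def flatten_def split: sum.split)

lemma flatten_inject: "flatten \<psi> = flatten \<phi> \<longleftrightarrow> \<psi> = \<phi>"
  by (metis flatten_simps ext prod.expand)

lemma flatten_add: "flatten (\<psi> + \<phi>) = flatten \<psi> + flatten \<phi>"
  and flatten_diff: "flatten (\<psi> - \<phi>) = flatten \<psi> - flatten \<phi>"
  and flatten_cscale: "flatten (cscale z \<psi>) = (\<lambda>i. z * flatten \<psi> i)"
  by (auto simp: fun_eq_iff flatten_def cscale_def split: sum.split)

lemma has_sum_sum_type:
  fixes f :: "'a + 'b \<Rightarrow> 'c :: topological_comm_monoid_add"
  assumes "((\<lambda>x. f (Inl x)) has_sum s) UNIV" "((\<lambda>y. f (Inr y)) has_sum t) UNIV"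
  shows "(f has_sum (s + t)) UNIV"
proof -
  have "(f has_sum s) (range Inl)" "(f has_sum t) (range Inr)"
    using assms by (simp_all add: has_sum_reindex o_def)
  then have "(f has_sum (s + t)) (range Inl \<union> range Inr)"
    by (rule has_sum_Un_disjoint) auto
  then show ?thesis by (simp add: UNIV_sum)
qed

lemma summable_on_sum_type:
  fixes f :: "'a + 'b \<Rightarrow> 'c :: banach"
  assumes "f summable_on UNIV"
  shows "(\<lambda>x. f (Inl x)) summable_on UNIV" "(\<lambda>y. f (Inr y)) summable_on UNIV"
  using summable_on_subset_banach[OF assms, of "range Inl"] summable_on_subset_banach[OF assms, of "range Inr"]
  by (simp_all add: summable_on_reindex o_def)

lemma infsum_sum_type:
  fixes f :: "'a + 'b \<Rightarrow> 'c :: banach"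
  assumes "f summable_on UNIV"
  shows "infsum f UNIV = (\<Sum>\<^sub>\<infinity>x. f (Inl x)) + (\<Sum>\<^sub>\<infinity>y. f (Inr y))"
  by (intro infsumI has_sum_sum_type has_sum_infsum summable_on_sum_type assms)

lemma ell2_sum_iff: "\<psi> \<in> ell2_sum \<longleftrightarrow> flatten \<psi> \<in> l2"
proof
  assume "\<psi> \<in> ell2_sum"
  then have "((\<lambda>i. (cmod (flatten \<psi> i))\<^sup>2) has_sum
      (\<Sum>\<^sub>\<infinity>n. (cmod (fst \<psi> n))\<^sup>2) + (\<Sum>\<^sub>\<infinity>n. (cmod (snd \<psi> n))\<^sup>2)) UNIV"
    by (intro has_sum_sum_type) (auto simp: ell2_sum_def ell2_def)
  then show "flatten \<psi> \<in> l2" by (auto simp: l2_def summable_on_def)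
next
  assume "flatten \<psi> \<in> l2"
  then show "\<psi> \<in> ell2_sum"
    using summable_on_sum_type[of "\<lambda>i. (cmod (flatten \<psi> i))\<^sup>2"]
    by (auto simp: l2_def ell2_sum_def ell2_def mem_Times_iff)
qed

lemma ell2_sum_norm_eq: "\<psi> \<in> ell2_sum \<Longrightarrow> ell2_sum_norm \<psi> = l2_norm (flatten \<psi>)"
  using infsum_sum_type[of "\<lambda>i. (cmod (flatten \<psi> i))\<^sup>2"]
  by (simp add: ell2_sum_iff l2_def l2_norm_def ell2_sum_norm_def)

lemma ell2_sum_add: "\<psi> \<in> ell2_sum \<Longrightarrow> \<phi> \<in> ell2_sum \<Longrightarrow> \<psi> + \<phi> \<in> ell2_sum"
  by (simp add: ell2_sum_iff flatten_add l2_add)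

lemma ell2_sum_cscale: "\<psi> \<in> ell2_sum \<Longrightarrow> cscale z \<psi> \<in> ell2_sum"
  by (simp add: ell2_sum_iff flatten_cscale l2_cmult)

lemma cscale_minus_one: "cscale (-1) \<psi> = - \<psi>"
  by (simp add: cscale_def prod_eq_iff fun_eq_iff)

lemma ell2_sum_diff: "\<psi> \<in> ell2_sum \<Longrightarrow> \<phi> \<in> ell2_sum \<Longrightarrow> \<psi> - \<phi> \<in> ell2_sum"
  using ell2_sum_add[of \<psi> "cscale (-1) \<phi>"] ell2_sum_cscale[of \<phi> "-1"]
  by (simp add: cscale_minus_one)

lemma ell2_sum_0: "0 \<in> ell2_sum"
  by (simp add: ell2_sum_def ell2_def zero_prod_def)

lemma ell2_sum_norm_nonneg [simp]: "0 \<le> ell2_sum_norm \<psi>"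
  by (simp add: ell2_sum_norm_def infsum_nonneg)

lemma ell2_sum_norm_cscale: "\<psi> \<in> ell2_sum \<Longrightarrow> ell2_sum_norm (cscale z \<psi>) = cmod z * ell2_sum_norm \<psi>"
  by (simp add: ell2_sum_norm_eq ell2_sum_cscale flatten_cscale l2_norm_cmult)

lemma ell2_sum_norm_triangle:
  "\<psi> \<in> ell2_sum \<Longrightarrow> \<phi> \<in> ell2_sum \<Longrightarrow> ell2_sum_norm (\<psi> + \<phi>) \<le> ell2_sum_norm \<psi> + ell2_sum_norm \<phi>"
  by (simp add: ell2_sum_norm_eq ell2_sum_add flatten_add) (simp add: ell2_sum_iff l2_norm_triangle)

lemma ell2_sum_norm_minus_commute:
  "\<psi> \<in> ell2_sum \<Longrightarrow> \<phi> \<in> ell2_sum \<Longrightarrow> ell2_sum_norm (\<psi> - \<phi>) = ell2_sum_norm (\<phi> - \<psi>)"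
  using ell2_sum_norm_cscale[of "\<phi> - \<psi>" "-1"] by (simp add: ell2_sum_diff cscale_minus_one)

lemma ell2_sum_norm_eq_0_iff: "\<psi> \<in> ell2_sum \<Longrightarrow> ell2_sum_norm \<psi> = 0 \<longleftrightarrow> \<psi> = 0"
proof -
  assume "\<psi> \<in> ell2_sum"
  moreover have "flatten \<psi> = (\<lambda>_. 0) \<longleftrightarrow> flatten \<psi> = flatten 0"
    by (auto simp: flatten_def fun_eq_iff split: sum.split)
  ultimately show ?thesis
    by (simp add: ell2_sum_norm_eq ell2_sum_iff l2_norm_eq_0_iff flatten_inject)
qed

text \<open>\<open>Metric_space\<close> demands symmetry on the whole type, hence the junk value off \<open>ell2_sum\<close>.\<close>

definition ell2_sum_dist :: "chain_state \<Rightarrow> chain_state \<Rightarrow> real" where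
  "ell2_sum_dist \<psi> \<phi> = (if \<psi> \<in> ell2_sum \<and> \<phi> \<in> ell2_sum then ell2_sum_norm (\<psi> - \<phi>) else 0)"

lemma Metric_space_ell2_sum: "Metric_space ell2_sum ell2_sum_dist"
proof
  fix \<psi> \<phi> \<xi> assume \<psi>: "\<psi> \<in> ell2_sum" and \<phi>: "\<phi> \<in> ell2_sum" and \<xi>: "\<xi> \<in> ell2_sum"
  have "ell2_sum_norm ((\<psi> - \<phi>) + (\<phi> - \<xi>)) \<le> ell2_sum_norm (\<psi> - \<phi>) + ell2_sum_norm (\<phi> - \<xi>)"
    using \<psi> \<phi> \<xi> by (intro ell2_sum_norm_triangle ell2_sum_diff)
  then show "ell2_sum_dist \<psi> \<xi> \<le> ell2_sum_dist \<psi> \<phi> + ell2_sum_dist \<phi> \<xi>"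
    using \<psi> \<phi> \<xi> by (simp add: ell2_sum_dist_def)
qed (auto simp: ell2_sum_dist_def ell2_sum_norm_minus_commute ell2_sum_norm_eq_0_iff ell2_sum_diff)

lemma mcomplete_ell2_sum: "Metric_space.mcomplete ell2_sum ell2_sum_dist"
  unfolding Metric_space.mcomplete_def[OF Metric_space_ell2_sum]
proof (intro allI impI)
  fix \<sigma> assume "Metric_space.MCauchy ell2_sum ell2_sum_dist \<sigma>"
  note cauchy = this[unfolded Metric_space.MCauchy_def[OF Metric_space_ell2_sum]]
  then have \<sigma>: "\<sigma> n \<in> ell2_sum" for n by auto
  have "\<exists>N. \<forall>m\<ge>N. \<forall>n\<ge>N. l2_norm (flatten (\<sigma> m) - flatten (\<sigma> n)) < e" if "e > 0" for e
    using cauchy that \<sigma>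
    by (simp add: ell2_sum_dist_def ell2_sum_norm_eq ell2_sum_diff flip: flatten_diff)
  then obtain f where f: "f \<in> l2" "(\<lambda>n. l2_norm (flatten (\<sigma> n) - f)) \<longlonglongrightarrow> 0"
    using l2_complete[of "\<lambda>n. flatten (\<sigma> n)"] \<sigma> by (metis ell2_sum_iff)
  have "unflatten f \<in> ell2_sum" using f by (simp add: ell2_sum_iff)
  then have "limitin (Metric_space.mtopology ell2_sum ell2_sum_dist) \<sigma> (unflatten f) sequentially"
    unfolding Metric_space.limitin_metric[OF Metric_space_ell2_sum]
    using \<sigma> f(2)
    by (auto simp: ell2_sum_dist_def ell2_sum_norm_eq ell2_sum_diff flatten_diff tendsto_iff)
  then show "\<exists>x. limitin (Metric_space.mtopology ell2_sum ell2_sum_dist) \<sigma> x sequentially" ..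
qed

lemma ell2_sum_contraction_fixpoint:
  assumes maps: "\<And>\<psi>. \<psi> \<in> ell2_sum \<Longrightarrow> G \<psi> \<in> ell2_sum" and "q < 1"
    and contr: "\<And>\<psi> \<phi>. \<psi> \<in> ell2_sum \<Longrightarrow> \<phi> \<in> ell2_sum \<Longrightarrow>
      ell2_sum_norm (G \<psi> - G \<phi>) \<le> q * ell2_sum_norm (\<psi> - \<phi>)"
  obtains \<psi> where "\<psi> \<in> ell2_sum" "G \<psi> = \<psi>"
proof (rule Metric_space.Banach_fixedpoint_thm[OF Metric_space_ell2_sum mcomplete_ell2_sum])
  show "ell2_sum \<noteq> {}" using ell2_sum_0 by blast
  show "ell2_sum_dist (G \<psi>) (G \<phi>) \<le> q * ell2_sum_dist \<psi> \<phi>" if "\<psi> \<in> ell2_sum" "\<phi> \<in> ell2_sum" for \<psi> \<phi>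
    using contr maps that by (simp add: ell2_sum_dist_def)
qed (use maps \<open>q < 1\<close> that in auto)

section \<open>Invertibility as a lower bound plus surjectivity\<close>

definition chain_linear :: "(chain_state \<Rightarrow> chain_state) \<Rightarrow> bool" where
  "chain_linear S \<longleftrightarrow>
     (\<forall>\<psi>\<in>ell2_sum. S \<psi> \<in> ell2_sum) \<and>
     (\<forall>\<psi>\<in>ell2_sum. \<forall>\<phi>\<in>ell2_sum. S (\<psi> + \<phi>) = S \<psi> + S \<phi>) \<and>
     (\<forall>z. \<forall>\<psi>\<in>ell2_sum. S (cscale z \<psi>) = cscale z (S \<psi>))"

lemma chain_linear_diff:
  assumes "chain_linear S" "\<psi> \<in> ell2_sum" "\<phi> \<in> ell2_sum"
  shows "S (\<psi> - \<phi>) = S \<psi> - S \<phi>"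
  using assms ell2_sum_cscale[of \<phi> "-1"]
  by (simp add: chain_linear_def flip: cscale_minus_one add: diff_conv_add_uminus)

lemma cscale_add: "cscale z (\<psi> + \<phi>) = cscale z \<psi> + cscale z \<phi>"
  and cscale_diff: "cscale z (\<psi> - \<phi>) = cscale z \<psi> - cscale z \<phi>"
  and cscale_cscale: "cscale z (cscale w \<psi>) = cscale (z * w) \<psi>"
  and cscale_diff_left: "cscale (z - w) \<psi> = cscale z \<psi> - cscale w \<psi>"
  and cscale_1: "cscale 1 \<psi> = \<psi>"
  by (auto simp: cscale_def prod_eq_iff fun_eq_iff algebra_simps)

lemma chain_linear_shift:
  assumes "chain_linear T"
  shows "chain_linear (\<lambda>\<psi>. T \<psi> - cscale z \<psi>)"
  using assms unfolding chain_linear_def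
  by (simp add: ell2_sum_diff ell2_sum_cscale cscale_add cscale_diff cscale_cscale mult.commute)

text \<open>For linear \<open>S\<close> and c > 0 this says that \<open>S\<close> is invertible on
  \<open>ell2_sum\<close> with inverse of norm at most 1/c, without mentioning the inverse.\<close>

definition expanding_onto :: "real \<Rightarrow> (chain_state \<Rightarrow> chain_state) \<Rightarrow> bool" where
  "expanding_onto c S \<longleftrightarrow>
     S ` ell2_sum = ell2_sum \<and> (\<forall>\<psi>\<in>ell2_sum. c * ell2_sum_norm \<psi> \<le> ell2_sum_norm (S \<psi>))"

lemma expanding_onto_inj:
  assumes "chain_linear S" "expanding_onto c S" "c > 0"
  shows "inj_on S ell2_sum"
proof (rule inj_onI)
  fix \<psi> \<phi> assume \<psi>: "\<psi> \<in> ell2_sum" and \<phi>: "\<phi> \<in> ell2_sum" and eq: "S \<psi> = S \<phi>"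
  have "c * ell2_sum_norm (\<psi> - \<phi>) \<le> ell2_sum_norm (S (\<psi> - \<phi>))"
    using assms(2) \<psi> \<phi> by (simp add: expanding_onto_def ell2_sum_diff)
  also have "\<dots> = 0"
    using eq chain_linear_diff[OF assms(1) \<psi> \<phi>] ell2_sum_norm_eq_0_iff[OF ell2_sum_0] by simp
  finally have "ell2_sum_norm (\<psi> - \<phi>) = 0"
    using \<open>c > 0\<close> by (simp add: mult_le_0_iff order_antisym)
  then show "\<psi> = \<phi>"
    using ell2_sum_norm_eq_0_iff[OF ell2_sum_diff[OF \<psi> \<phi>]] by simp
qed

lemma resolvent_set_iff:
  assumes T: "chain_linear T"
  shows "z \<in> resolvent_set T \<longleftrightarrow> (\<exists>c>0. expanding_onto c (\<lambda>\<psi>. T \<psi> - cscale z \<psi>))"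
proof
  define S where "S = (\<lambda>\<psi>. T \<psi> - cscale z \<psi>)"
  have S: "chain_linear S" unfolding S_def by (rule chain_linear_shift[OF T])
  {
    assume "z \<in> resolvent_set T"
    then obtain R where R: "bounded_operator R"
      and inv: "\<And>\<psi>. \<psi> \<in> ell2_sum \<Longrightarrow> R (S \<psi>) = \<psi>" "\<And>\<psi>. \<psi> \<in> ell2_sum \<Longrightarrow> S (R \<psi>) = \<psi>"
      unfolding resolvent_set_def S_def by blast
    obtain K where K: "\<And>\<psi>. \<psi> \<in> ell2_sum \<Longrightarrow> ell2_sum_norm (R \<psi>) \<le> K * ell2_sum_norm \<psi>"
      using R unfolding bounded_operator_def by blast
    \<comment> \<open>\<open>bounded_operator\<close> says nothing about the sign of
      \<open>K\<close>; passing to |K| + 1 makes the reciprocal a positive constant.\<close>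
    have "expanding_onto (1 / (\<bar>K\<bar> + 1)) S"
      unfolding expanding_onto_def
    proof (intro conjI ballI subset_antisym subsetI)
      fix \<psi> assume "\<psi> \<in> ell2_sum"
      then show "\<psi> \<in> S ` ell2_sum"
        using inv(2) R by (metis bounded_operator_def image_eqI)
    next
      fix \<psi> assume \<psi>: "\<psi> \<in> ell2_sum"
      then have "ell2_sum_norm \<psi> \<le> K * ell2_sum_norm (S \<psi>)"
        using K[of "S \<psi>"] inv(1) S by (simp add: chain_linear_def)
      also have "\<dots> \<le> (\<bar>K\<bar> + 1) * ell2_sum_norm (S \<psi>)"
        by (intro mult_right_mono) auto
      finally show "1 / (\<bar>K\<bar> + 1) * ell2_sum_norm \<psi> \<le> ell2_sum_norm (S \<psi>)"
        by (simp add: field_simps add_pos_nonneg)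
    qed (use S in \<open>auto simp: chain_linear_def\<close>)
    then show "\<exists>c>0. expanding_onto c (\<lambda>\<psi>. T \<psi> - cscale z \<psi>)"
      unfolding S_def by (intro exI[of _ "1 / (\<bar>K\<bar> + 1)"]) (simp add: add_nonneg_pos)
  next
    assume "\<exists>c>0. expanding_onto c (\<lambda>\<psi>. T \<psi> - cscale z \<psi>)"
    then obtain c where "c > 0" and c: "expanding_onto c S" unfolding S_def by blast
    have inj: "inj_on S ell2_sum" by (rule expanding_onto_inj[OF S c \<open>c > 0\<close>])
    have onto: "S ` ell2_sum = ell2_sum" using c by (simp add: expanding_onto_def)
    define R where "R = inv_into ell2_sum S"
    have R: "R \<psi> \<in> ell2_sum" "S (R \<psi>) = \<psi>" if "\<psi> \<in> ell2_sum" for \<psi>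
      using that onto unfolding R_def by (auto simp: inv_into_into f_inv_into_f)
    have RS: "R (S \<psi>) = \<psi>" if "\<psi> \<in> ell2_sum" for \<psi>
      using that inj unfolding R_def by simp
    \<comment> \<open>Additivity and homogeneity of the inverse follow from this uniqueness and the
      linearity of \<open>S\<close>.\<close>
    have R_eqI: "R \<psi> = \<phi>" if "\<phi> \<in> ell2_sum" "S \<phi> = \<psi>" for \<psi> \<phi>
      using RS that by blast
    have "bounded_operator R"
      unfolding bounded_operator_def
    proof (intro conjI ballI allI exI)
      show "ell2_sum_norm (R \<psi>) \<le> 1 / c * ell2_sum_norm \<psi>" if "\<psi> \<in> ell2_sum" for \<psi>
        using c R[OF that] \<open>c > 0\<close> by (fastforce simp: expanding_onto_def field_simps)
      show "R (\<psi> + \<phi>) = R \<psi> + R \<phi>" if "\<psi> \<in> ell2_sum" "\<phi> \<in> ell2_sum" for \<psi> \<phi>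
        using R[OF that(1)] R[OF that(2)] S by (intro R_eqI) (auto simp: ell2_sum_add chain_linear_def)
      show "R (cscale w \<psi>) = cscale w (R \<psi>)" if "\<psi> \<in> ell2_sum" for \<psi> w
        using R[OF that] S by (intro R_eqI) (auto simp: ell2_sum_cscale chain_linear_def)
    qed (rule R)
    then show "z \<in> resolvent_set T"
      using R RS unfolding resolvent_set_def S_def by blast
  }
qed

lemma expanding_onto_perturb:
  assumes S0: "chain_linear S0" and S: "chain_linear S"
    and c: "expanding_onto c S0" and d: "d < c"
    and close: "\<And>\<psi>. \<psi> \<in> ell2_sum \<Longrightarrow> ell2_sum_norm (S0 \<psi> - S \<psi>) \<le> d * ell2_sum_norm \<psi>"
    and "c > 0"
  shows "expanding_onto (c - d) S"
  unfolding expanding_onto_def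
proof (intro conjI ballI subset_antisym subsetI)
  have S0E: "S0 \<psi> \<in> ell2_sum" and SE: "S \<psi> \<in> ell2_sum" if "\<psi> \<in> ell2_sum" for \<psi>
    using S0 S that by (auto simp: chain_linear_def)
  then show "\<And>\<psi>. \<psi> \<in> S ` ell2_sum \<Longrightarrow> \<psi> \<in> ell2_sum" by auto
  have lower: "c * ell2_sum_norm \<psi> \<le> ell2_sum_norm (S0 \<psi>)" if "\<psi> \<in> ell2_sum" for \<psi>
    using c that by (simp add: expanding_onto_def)
  show "(c - d) * ell2_sum_norm \<psi> \<le> ell2_sum_norm (S \<psi>)" if \<psi>: "\<psi> \<in> ell2_sum" for \<psi>
  proof -
    have "c * ell2_sum_norm \<psi> \<le> ell2_sum_norm (S0 \<psi> - S \<psi> + S \<psi>)"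
      using lower[OF \<psi>] by simp
    also have "\<dots> \<le> ell2_sum_norm (S0 \<psi> - S \<psi>) + ell2_sum_norm (S \<psi>)"
      using \<psi> by (intro ell2_sum_norm_triangle ell2_sum_diff S0E SE)
    finally show ?thesis using close[OF \<psi>] by (simp add: algebra_simps)
  qed
  fix \<phi> assume \<phi>: "\<phi> \<in> ell2_sum"
  define R where "R = inv_into ell2_sum S0"
  have onto: "S0 ` ell2_sum = ell2_sum" using c by (simp add: expanding_onto_def)
  then have R: "R \<xi> \<in> ell2_sum" "S0 (R \<xi>) = \<xi>" if "\<xi> \<in> ell2_sum" for \<xi>
    using that unfolding R_def by (auto simp: inv_into_into f_inv_into_f)
  \<comment> \<open>\<open>S \<psi> = \<phi>\<close> is equivalent to \<open>S0 \<psi> = S0 \<psi> - S \<psi> + \<phi>\<close>, i.e. to \<open>\<psi>\<close> being a fixed point of \<open>G\<close>.\<close>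
  define G where "G = (\<lambda>\<psi>. R (S0 \<psi> - S \<psi> + \<phi>))"
  have arg: "S0 \<psi> - S \<psi> + \<phi> \<in> ell2_sum" if "\<psi> \<in> ell2_sum" for \<psi>
    using that \<phi> by (intro ell2_sum_add ell2_sum_diff S0E SE)
  obtain \<psi> where \<psi>: "\<psi> \<in> ell2_sum" "G \<psi> = \<psi>"
  proof (rule ell2_sum_contraction_fixpoint)
    show "G \<psi> \<in> ell2_sum" if "\<psi> \<in> ell2_sum" for \<psi>
      unfolding G_def by (intro R arg that)
    show "d / c < 1" using d \<open>c > 0\<close> by simp
    fix \<psi> \<xi> assume \<psi>: "\<psi> \<in> ell2_sum" and \<xi>: "\<xi> \<in> ell2_sum"
    have "c * ell2_sum_norm (G \<psi> - G \<xi>) \<le> ell2_sum_norm (S0 (G \<psi> - G \<xi>))"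
      unfolding G_def using \<psi> \<xi> by (intro lower ell2_sum_diff R arg)
    also have "S0 (G \<psi> - G \<xi>) = (S0 \<psi> - S \<psi> + \<phi>) - (S0 \<xi> - S \<xi> + \<phi>)"
      unfolding G_def using R[OF arg[OF \<psi>]] R[OF arg[OF \<xi>]] by (simp add: chain_linear_diff[OF S0])
    also have "\<dots> = S0 (\<psi> - \<xi>) - S (\<psi> - \<xi>)"
      using \<psi> \<xi> by (simp add: chain_linear_diff[OF S0] chain_linear_diff[OF S])
    also have "ell2_sum_norm \<dots> \<le> d * ell2_sum_norm (\<psi> - \<xi>)"
      using \<psi> \<xi> by (intro close ell2_sum_diff)
    finally show "ell2_sum_norm (G \<psi> - G \<xi>) \<le> d / c * ell2_sum_norm (\<psi> - \<xi>)"
      using \<open>c > 0\<close> by (simp add: field_simps)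
  qed
  have "S0 \<psi> = S0 \<psi> - S \<psi> + \<phi>"
    using R(2)[OF arg[OF \<psi>(1)]] \<psi>(2) by (simp add: G_def)
  then have "S \<psi> = \<phi>" by (simp add: algebra_simps)
  then show "\<phi> \<in> S ` ell2_sum" using \<psi>(1) by blast
qed

section \<open>Kernels of the coupled chain\<close>

lemma schur_bounded_transpose: "schur_bounded k M \<Longrightarrow> schur_bounded (\<lambda>i j. k j i) M"
  by (auto simp: schur_bounded_def)

definition block_kernel ::
    "('a \<Rightarrow> 'a \<Rightarrow> complex) \<Rightarrow> ('a \<Rightarrow> 'b \<Rightarrow> complex) \<Rightarrow> ('b \<Rightarrow> 'a \<Rightarrow> complex) \<Rightarrow> ('b \<Rightarrow> 'b \<Rightarrow> complex) \<Rightarrow>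
      'a + 'b \<Rightarrow> 'a + 'b \<Rightarrow> complex" where
  "block_kernel k11 k12 k21 k22 i j =
     (case i of Inl a \<Rightarrow> case_sum (k11 a) (k12 a) j | Inr b \<Rightarrow> case_sum (k21 b) (k22 b) j)"

lemma block_kernel_simps [simp]:
  "block_kernel k11 k12 k21 k22 (Inl a) (Inl a') = k11 a a'"
  "block_kernel k11 k12 k21 k22 (Inl a) (Inr b) = k12 a b"
  "block_kernel k11 k12 k21 k22 (Inr b) (Inl a) = k21 b a"
  "block_kernel k11 k12 k21 k22 (Inr b) (Inr b') = k22 b b'"
  by (simp_all add: block_kernel_def)

lemma sum_sum_type:
  assumes "finite F"
  shows "sum f F = (\<Sum>x\<in>Inl -` F. f (Inl x)) + (\<Sum>y\<in>Inr -` F. f (Inr y))"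
proof -
  have "F = Inl -` F <+> Inr -` F"
    by (auto simp: Plus_def image_iff) (metis sum.exhaust vimageI2)+
  moreover have "finite (Inl -` F)" "finite (Inr -` F)"
    using assms by (auto intro: finite_vimageI)
  ultimately show ?thesis
    by (metis (no_types, lifting) comp_apply sum.Plus sum.cong)
qed

text \<open>A row or a column meets two of the four blocks; adding all four constants gives one
  bound valid for every row and column.\<close>

lemma schur_bounded_block_kernel:
  assumes "schur_bounded k11 M11" "schur_bounded k12 M12" "schur_bounded k21 M21" "schur_bounded k22 M22"
  shows "schur_bounded (block_kernel k11 k12 k21 k22) (M11 + M12 + M21 + M22)"
proof -
  have nonneg: "0 \<le> M11" "0 \<le> M12" "0 \<le> M21" "0 \<le> M22"
    using assms by (simp_all add: schur_bounded_def)
  have bounds: "finite F \<Longrightarrow> (\<Sum>a'\<in>F. cmod (k11 a a')) \<le> M11" "finite G \<Longrightarrow> (\<Sum>b\<in>G. cmod (k12 a b)) \<le> M12"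
      "finite F \<Longrightarrow> (\<Sum>a\<in>F. cmod (k21 b a)) \<le> M21" "finite G \<Longrightarrow> (\<Sum>b'\<in>G. cmod (k22 b b')) \<le> M22"
      "finite F \<Longrightarrow> (\<Sum>a'\<in>F. cmod (k11 a' a)) \<le> M11" "finite F \<Longrightarrow> (\<Sum>a\<in>F. cmod (k12 a b)) \<le> M12"
      "finite G \<Longrightarrow> (\<Sum>b\<in>G. cmod (k21 b a)) \<le> M21" "finite G \<Longrightarrow> (\<Sum>b'\<in>G. cmod (k22 b' b)) \<le> M22"
    for F G a b
    using assms by (simp_all add: schur_bounded_def)
  have fin: "finite (Inl -` F)" "finite (Inr -` F)" if "finite F" for F :: "('a + 'b) set"
    using that by (auto intro: finite_vimageI)
  show ?thesis
    unfolding schur_bounded_def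
  proof (intro conjI allI impI)
    fix i :: "'a + 'b" and F :: "('a + 'b) set" assume F: "finite F"
    show "(\<Sum>j\<in>F. cmod (block_kernel k11 k12 k21 k22 i j)) \<le> M11 + M12 + M21 + M22"
    proof (cases i)
      case (Inl a)
      then show ?thesis
        using bounds(1)[OF fin(1)[OF F], of a] bounds(2)[OF fin(2)[OF F], of a] nonneg
        by (simp add: sum_sum_type[OF F])
    next
      case (Inr b)
      then show ?thesis
        using bounds(3)[OF fin(1)[OF F], of b] bounds(4)[OF fin(2)[OF F], of b] nonneg
        by (simp add: sum_sum_type[OF F])
    qed
    show "(\<Sum>j\<in>F. cmod (block_kernel k11 k12 k21 k22 j i)) \<le> M11 + M12 + M21 + M22"
    proof (cases i)
      case (Inl a)
      then show ?thesis
        using bounds(5)[OF fin(1)[OF F], of a] bounds(7)[OF fin(2)[OF F], of a] nonneg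
        by (simp add: sum_sum_type[OF F])
    next
      case (Inr b)
      then show ?thesis
        using bounds(6)[OF fin(1)[OF F], of b] bounds(8)[OF fin(2)[OF F], of b] nonneg
        by (simp add: sum_sum_type[OF F])
    qed
  qed (use nonneg in simp)
qed

definition laplace_kernel :: "int \<Rightarrow> int \<Rightarrow> complex" where
  "laplace_kernel n n' = (if n' = n then 2 else if n' \<in> {n - 1, n + 1} then -1 else 0)"

lemma laplace_kernel_sym: "laplace_kernel n n' = laplace_kernel n' n"
  by (auto simp: laplace_kernel_def)

lemma schur_bounded_laplace_kernel: "schur_bounded laplace_kernel 4"
proof -
  have "(\<Sum>n'\<in>F. cmod (laplace_kernel n n')) \<le> 4" if "finite F" for n F
  proof -
    have "(\<Sum>n'\<in>F. cmod (laplace_kernel n n')) \<le> (\<Sum>n'\<in>F \<union> {n - 1, n, n + 1}. cmod (laplace_kernel n n'))"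
      using that by (intro sum_mono2) auto
    also have "\<dots> = (\<Sum>n'\<in>{n - 1, n, n + 1}. cmod (laplace_kernel n n'))"
      using that by (intro sum.mono_neutral_right) (auto simp: laplace_kernel_def)
    also have "\<dots> = 4" by (simp add: laplace_kernel_def)
    finally show ?thesis .
  qed
  then show ?thesis
    by (simp add: schur_bounded_def laplace_kernel_sym[where n' = i for i])
qed

lemma laplace_kernel_infsum:
  "(\<Sum>\<^sub>\<infinity>n'. laplace_kernel n n' * \<phi> n') = - discrete_laplacian \<phi> n"
proof -
  have "(\<Sum>\<^sub>\<infinity>n'. laplace_kernel n n' * \<phi> n') = (\<Sum>\<^sub>\<infinity>n'\<in>{n - 1, n, n + 1}. laplace_kernel n n' * \<phi> n')"
    by (intro infsum_cong_neutral) (auto simp: laplace_kernel_def)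
  then show ?thesis
    by (simp add: laplace_kernel_def discrete_laplacian_def)
qed

section \<open>Exponential sums over lattices and decay of the hopping terms\<close>

definition lattice_bound :: "real \<Rightarrow> real \<Rightarrow> real" where
  "lattice_bound c \<alpha> = exp (c * \<alpha>) * (2 / (1 - exp (- (c * \<alpha>))))"

lemma lattice_bound_nonneg: "c > 0 \<Longrightarrow> \<alpha> > 0 \<Longrightarrow> 0 \<le> lattice_bound c \<alpha>"
  by (simp add: lattice_bound_def)

text \<open>On either side of \<open>m\<close> the exponent is injective, so each half is dominated
  by a full geometric series; hence the factor 2.\<close>

lemma geometric_sum_int_le:
  fixes q :: real
  assumes q: "0 \<le> q" "q < 1" and F: "finite F"
  shows "(\<Sum>j\<in>F. q ^ nat \<bar>j - m\<bar>) \<le> 2 / (1 - q)"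
proof -
  have half: "(\<Sum>j\<in>G. q ^ nat \<bar>j - m\<bar>) \<le> 1 / (1 - q)" if "finite G" "inj_on (\<lambda>j. nat \<bar>j - m\<bar>) G" for G
  proof -
    have "(\<Sum>j\<in>G. q ^ nat \<bar>j - m\<bar>) = (\<Sum>i\<in>(\<lambda>j. nat \<bar>j - m\<bar>) ` G. q ^ i)"
      using that(2) by (simp add: sum.reindex)
    also have "\<dots> \<le> (\<Sum>i. q ^ i)"
      using q that(1) by (intro sum_le_suminf) (auto simp: summable_geometric)
    also have "\<dots> = 1 / (1 - q)" using q by (simp add: suminf_geometric)
    finally show ?thesis .
  qed
  have "(\<Sum>j\<in>F. q ^ nat \<bar>j - m\<bar>) =
      (\<Sum>j\<in>F \<inter> {m..}. q ^ nat \<bar>j - m\<bar>) + (\<Sum>j\<in>F \<inter> {..<m}. q ^ nat \<bar>j - m\<bar>)"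
    using F by (subst sum.union_disjoint[symmetric]) (auto intro!: sum.cong)
  also have "\<dots> \<le> 1 / (1 - q) + 1 / (1 - q)"
    using F by (intro add_mono half) (auto simp: inj_on_def)
  finally show ?thesis by simp
qed

text \<open>The lattice point \<alpha>m just below x is at distance at most \<alpha>. Measuring from
  it instead of x costs the factor exp(c\<alpha>) in \<open>lattice_bound\<close> and leaves a
  two-sided geometric sum of ratio exp(-c\<alpha>). The bound is uniform in x.\<close>

lemma exp_lattice_sum_le:
  fixes F :: "int set"
  assumes c: "c > 0" and \<alpha>: "\<alpha> > 0" and F: "finite F"
  shows "(\<Sum>j\<in>F. exp (- c * \<bar>x - \<alpha> * of_int j\<bar>)) \<le> lattice_bound c \<alpha>"
proof -
  define q where "q = exp (- (c * \<alpha>))"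
  define m where "m = \<lfloor>x / \<alpha>\<rfloor>"
  have q: "0 \<le> q" "q < 1" using c \<alpha> by (auto simp: q_def)
  have le: "exp (- c * \<bar>x - \<alpha> * of_int j\<bar>) \<le> exp (c * \<alpha>) * q ^ nat \<bar>j - m\<bar>" for j
  proof -
    have "of_int m \<le> x / \<alpha>" "x / \<alpha> < of_int m + 1" by (auto simp: m_def)
    then have "of_int m * \<alpha> \<le> x" "x < (of_int m + 1) * \<alpha>"
      using \<alpha> by (auto simp: field_simps)
    then have "\<bar>x - \<alpha> * of_int m\<bar> \<le> \<alpha>" by (simp add: algebra_simps)
    moreover have "\<alpha> * \<bar>of_int j - of_int m\<bar> = \<bar>\<alpha> * of_int j - \<alpha> * of_int m\<bar>"
      using \<alpha> by (simp add: abs_mult flip: right_diff_distrib)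
    ultimately have "\<alpha> * \<bar>of_int j - of_int m\<bar> - \<alpha> \<le> \<bar>x - \<alpha> * of_int j\<bar>" by linarith
    then have "c * (\<alpha> * \<bar>of_int j - of_int m\<bar> - \<alpha>) \<le> c * \<bar>x - \<alpha> * of_int j\<bar>"
      using c by (intro mult_left_mono) auto
    then have "exp (- c * \<bar>x - \<alpha> * of_int j\<bar>) \<le> exp (c * \<alpha> + of_nat (nat \<bar>j - m\<bar>) * - (c * \<alpha>))"
      by (simp add: algebra_simps)
    also have "\<dots> = exp (c * \<alpha>) * q ^ nat \<bar>j - m\<bar>"
      by (simp only: exp_add exp_of_nat_mult q_def)
    finally show ?thesis .
  qed
  have "(\<Sum>j\<in>F. exp (- c * \<bar>x - \<alpha> * of_int j\<bar>)) \<le> exp (c * \<alpha>) * (\<Sum>j\<in>F. q ^ nat \<bar>j - m\<bar>)"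
    unfolding sum_distrib_left by (intro sum_mono le)
  also have "\<dots> \<le> lattice_bound c \<alpha>"
    unfolding lattice_bound_def q_def[symmetric]
    by (intro mult_left_mono geometric_sum_int_le q F) simp
  finally show ?thesis .
qed

definition hopping_kernel :: "(real \<Rightarrow> real) \<Rightarrow> real \<Rightarrow> real \<Rightarrow> int \<Rightarrow> int \<Rightarrow> complex" where
  "hopping_kernel g \<alpha> b n n' = complex_of_real (g (of_int n - \<alpha> * of_int n' - b))"

text \<open>Along a row the arguments of \<open>g\<close> have spacing \<alpha>, along a column
  spacing 1, whence the two lattice bounds. Since \<open>b\<close> only moves the centre, the
  constant is the same for all offsets.\<close>

lemma schur_bounded_hopping_kernel:
  assumes g: "\<And>y. \<bar>g y\<bar> \<le> C * exp (- c * \<bar>y\<bar>)" and c: "c > 0" and \<alpha>: "\<alpha> > 0"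
  shows "schur_bounded (hopping_kernel g \<alpha> b) (C * (lattice_bound c \<alpha> + lattice_bound c 1))"
proof -
  have C: "0 \<le> C" using order_trans[OF abs_ge_zero g[of 0]] by simp
  note nonneg = lattice_bound_nonneg[OF c \<alpha>] lattice_bound_nonneg[OF c, of 1]
  show ?thesis
    unfolding schur_bounded_def
  proof (intro conjI allI impI)
    fix n and F :: "int set" assume F: "finite F"
    have "(\<Sum>n'\<in>F. cmod (hopping_kernel g \<alpha> b n n')) \<le>
        (\<Sum>n'\<in>F. C * exp (- c * \<bar>(of_int n - b) - \<alpha> * of_int n'\<bar>))"
      unfolding hopping_kernel_def norm_of_real
      by (intro sum_mono order_trans[OF g]) (simp add: algebra_simps)
    also have "\<dots> \<le> C * lattice_bound c \<alpha>"
      unfolding sum_distrib_left[symmetric] by (intro mult_left_mono exp_lattice_sum_le c \<alpha> F C)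
    also have "\<dots> \<le> C * (lattice_bound c \<alpha> + lattice_bound c 1)"
      using C nonneg by (intro mult_left_mono) auto
    finally show "(\<Sum>n'\<in>F. cmod (hopping_kernel g \<alpha> b n n')) \<le> \<dots>" .
    have "(\<Sum>n'\<in>F. cmod (hopping_kernel g \<alpha> b n' n)) \<le>
        (\<Sum>n'\<in>F. C * exp (- c * \<bar>(\<alpha> * of_int n + b) - 1 * of_int n'\<bar>))"
      unfolding hopping_kernel_def norm_of_real
      by (intro sum_mono order_trans[OF g]) (simp add: algebra_simps abs_minus_commute)
    also have "\<dots> \<le> C * lattice_bound c 1"
      unfolding sum_distrib_left[symmetric] by (intro mult_left_mono exp_lattice_sum_le c F C) simp
    also have "\<dots> \<le> C * (lattice_bound c \<alpha> + lattice_bound c 1)"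
      using C nonneg by (intro mult_left_mono) auto
    finally show "(\<Sum>n'\<in>F. cmod (hopping_kernel g \<alpha> b n' n)) \<le> \<dots>" .
  qed (use C nonneg in auto)
qed

text \<open>Uniform continuity on a large interval handles bounded y; beyond it both values of h are
  tiny. Only half of the rate \<open>c\<close> survives in the conclusion, because the other half
  produces the factor \<open>e\<close> in the tail.\<close>

lemma exp_decay_modulus:
  fixes h :: "real \<Rightarrow> real"
  assumes cont: "continuous_on UNIV h" and c: "c > 0"
    and h: "\<And>y. \<bar>h y\<bar> \<le> C * exp (- c * \<bar>y\<bar>)" and e: "e > 0"
  obtains \<delta> where "\<delta> > 0" "\<And>t y. \<bar>t\<bar> < \<delta> \<Longrightarrow> \<bar>h y - h (y - t)\<bar> \<le> e * exp (- (c / 2) * \<bar>y\<bar>)"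
proof -
  have C: "0 \<le> C" using order_trans[OF abs_ge_zero h[of 0]] by simp
  \<comment> \<open>For |t| at most 1 the decay of h(y - t) costs a factor exp(c) relative to
    exp(-c|y|), so \<open>K\<close> bounds both values together. This is why \<delta> is cut off at
    1 and the interval below is widened by 1.\<close>
  define K where "K = C * (1 + exp c)"
  have K: "0 \<le> K" using C by (simp add: K_def add_nonneg_nonneg)
  \<comment> \<open>Chosen so that cN/2 = K/e; then x \<le> exp(x) at x = K/e makes the tail beyond
    \<open>N\<close> at most \<open>e\<close>.\<close>
  define N where "N = 2 / c * (K / e)"
  have N: "0 \<le> N" using K c e by (simp add: N_def)
  have KN: "K * exp (- (c / 2) * N) \<le> e"
  proof -
    have "K / e \<le> exp (K / e)" using exp_ge_add_one_self[of "K / e"] by linarith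
    also have "K / e = c / 2 * N" using c by (simp add: N_def)
    finally have "K / e \<le> exp (c / 2 * N)" using c by (simp add: N_def)
    then show ?thesis using e by (simp add: exp_minus field_simps)
  qed
  have "uniformly_continuous_on {- N - 1..N + 1} h"
    using cont by (intro compact_uniformly_continuous) (auto intro: continuous_on_subset)
  then obtain \<delta> where \<delta>: "\<delta> > 0"
    and uc: "\<And>x y. x \<in> {- N - 1..N + 1} \<Longrightarrow> y \<in> {- N - 1..N + 1} \<Longrightarrow> dist y x < \<delta> \<Longrightarrow>
      dist (h y) (h x) < e * exp (- (c / 2) * N)"
    unfolding uniformly_continuous_on_def using e by (metis exp_gt_zero mult_pos_pos)
  show thesis
  proof (rule that)
    show "min \<delta> 1 > 0" using \<delta> by simp
    fix t y :: real assume t: "\<bar>t\<bar> < min \<delta> 1"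
    show "\<bar>h y - h (y - t)\<bar> \<le> e * exp (- (c / 2) * \<bar>y\<bar>)"
    proof (cases "\<bar>y\<bar> \<le> N")
      case True
      then have "y \<in> {- N - 1..N + 1}" "y - t \<in> {- N - 1..N + 1}"
        unfolding atLeastAtMost_iff using t by linarith+
      then have "\<bar>h y - h (y - t)\<bar> < e * exp (- (c / 2) * N)"
        using uc[of "y - t" y] t by (auto simp: dist_real_def)
      also have "\<dots> \<le> e * exp (- (c / 2) * \<bar>y\<bar>)"
        using True c e by simp
      finally show ?thesis by simp
    next
      case False
      have "\<bar>y\<bar> \<le> \<bar>y - t\<bar> + 1" using t by linarith
      then have "c * \<bar>y\<bar> \<le> c * (\<bar>y - t\<bar> + 1)" using c by (intro mult_left_mono) auto
      then have "exp (- c * \<bar>y - t\<bar>) \<le> exp (c + - c * \<bar>y\<bar>)" by (simp add: algebra_simps)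
      then have "C * exp (- c * \<bar>y - t\<bar>) \<le> C * (exp c * exp (- c * \<bar>y\<bar>))"
        using C by (simp add: mult_left_mono flip: exp_add)
      then have "\<bar>h y - h (y - t)\<bar> \<le> K * exp (- c * \<bar>y\<bar>)"
        using h[of y] h[of "y - t"] by (simp add: K_def algebra_simps)
      also have "\<dots> = K * exp (- (c / 2) * \<bar>y\<bar>) * exp (- (c / 2) * \<bar>y\<bar>)"
        by (simp flip: exp_add)
      also have "\<dots> \<le> K * exp (- (c / 2) * N) * exp (- (c / 2) * \<bar>y\<bar>)"
        using False c K by (intro mult_right_mono mult_left_mono) auto
      also have "\<dots> \<le> e * exp (- (c / 2) * \<bar>y\<bar>)"
        using KN by (intro mult_right_mono) auto
      finally show ?thesis .
    qed
  qed
qed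

text \<open>The argument in the second equation is minus that of the first with n and n' exchanged,
  so the lower left block is a transposed hopping kernel of the reflected function. Its Schur bound
  then comes from decay alone; evenness enters in \<open>chain_kernel_hermitian\<close>.\<close>

definition chain_kernel :: "(real \<Rightarrow> real) \<Rightarrow> real \<Rightarrow> real \<Rightarrow> int + int \<Rightarrow> int + int \<Rightarrow> complex" where
  "chain_kernel h \<theta> b = block_kernel laplace_kernel (hopping_kernel h (1 - \<theta>) b)
     (\<lambda>n n'. hopping_kernel (\<lambda>y. h (- y)) (1 - \<theta>) b n' n) laplace_kernel"

lemma chain_kernel_hermitian:
  assumes "even_function h"
  shows "chain_kernel h \<theta> b j i = cnj (chain_kernel h \<theta> b i j)"
proof -
  have "cnj (laplace_kernel n n') = laplace_kernel n' n" for n n'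
    by (auto simp: laplace_kernel_def)
  then show ?thesis
    using assms unfolding chain_kernel_def
    by (cases i; cases j) (auto simp: hopping_kernel_def even_function_def)
qed

section \<open>Dense offsets and translations of the chains\<close>

lemma Kronecker_dense:
  fixes \<alpha> x :: real
  assumes "\<alpha> \<notin> \<rat>" "\<epsilon> > 0"
  obtains m k :: int where "\<bar>of_int m - \<alpha> * of_int k - x\<bar> < \<epsilon>"
proof -
  obtain k where k: "\<bar>frac (real k * \<alpha>) - frac (- x)\<bar> < \<epsilon>"
    using Kronecker_approx_1_explicit[OF assms(1) _ _ assms(2), of "frac (- x)"]
    by (metis frac_ge_0 frac_lt_1 less_imp_le)
  \<comment> \<open>Collecting the integer parts into m turns closeness of the fractional parts of
    k\<alpha> and -x into closeness of m - \<alpha>k to x.\<close>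
  have "frac (real k * \<alpha>) - frac (- x) = - (of_int (\<lfloor>real k * \<alpha>\<rfloor> - \<lfloor>- x\<rfloor>) - \<alpha> * of_int (int k) - x)"
    by (simp add: frac_def mult.commute)
  with k have "\<bar>of_int (\<lfloor>real k * \<alpha>\<rfloor> - \<lfloor>- x\<rfloor>) - \<alpha> * of_int (int k) - x\<bar> < \<epsilon>"
    by (simp only: abs_minus_cancel)
  then show thesis by (rule that)
qed

definition chain_translate :: "int \<Rightarrow> int \<Rightarrow> chain_state \<Rightarrow> chain_state" where
  "chain_translate m k \<psi> = ((\<lambda>n. fst \<psi> (n - m)), (\<lambda>n. snd \<psi> (n - k)))"

lemma bij_int_diff: "bij_betw (\<lambda>n :: int. n - m) UNIV UNIV"
  by (rule bij_betwI[where g = "\<lambda>n. n + m"]) auto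

lemma chain_translate_ell2_sum: "\<psi> \<in> ell2_sum \<Longrightarrow> chain_translate m k \<psi> \<in> ell2_sum"
  using summable_on_reindex_bij_betw[OF bij_int_diff, of "\<lambda>n. (cmod (fst \<psi> n))\<^sup>2" m]
    summable_on_reindex_bij_betw[OF bij_int_diff, of "\<lambda>n. (cmod (snd \<psi> n))\<^sup>2" k]
  by (auto simp: ell2_sum_def ell2_def chain_translate_def mem_Times_iff)

lemma ell2_sum_norm_chain_translate: "ell2_sum_norm (chain_translate m k \<psi>) = ell2_sum_norm \<psi>"
  using infsum_reindex_bij_betw[OF bij_int_diff, of "\<lambda>n. (cmod (fst \<psi> n))\<^sup>2" m]
    infsum_reindex_bij_betw[OF bij_int_diff, of "\<lambda>n. (cmod (snd \<psi> n))\<^sup>2" k]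
  by (simp add: ell2_sum_norm_def chain_translate_def)

lemma chain_translate_inverse: "chain_translate m k (chain_translate (- m) (- k) \<psi>) = \<psi>"
  by (simp add: chain_translate_def)

text \<open>The coupling sees n and n' only through n - (1 - \<theta>)n' - b, so shifting n by m and
  n' by k is absorbed by \<open>b\<close>. Reindexing \<open>infsum\<close> along a bijection
  requires no convergence, so the identity holds for every \<psi>.\<close>

lemma coupled_chain_translate:
  "coupled_chain h \<theta> (b + (of_int m - (1 - \<theta>) * of_int k)) (chain_translate m k \<psi>) =
     chain_translate m k (coupled_chain h \<theta> b \<psi>)"
proof -
  have "(\<Sum>\<^sub>\<infinity>n'. complex_of_real (h (of_int n - (1 - \<theta>) * of_int n'
            - (b + (of_int m - (1 - \<theta>) * of_int k)))) * snd \<psi> (n' - k)) =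
        (\<Sum>\<^sub>\<infinity>n'. complex_of_real (h (of_int (n - m) - (1 - \<theta>) * of_int n' - b)) * snd \<psi> n')" for n
    using infsum_reindex_bij_betw[OF bij_int_diff,
        of "\<lambda>n'. complex_of_real (h (of_int (n - m) - (1 - \<theta>) * of_int n' - b)) * snd \<psi> n'" k]
    by (simp add: algebra_simps)
  moreover have "(\<Sum>\<^sub>\<infinity>n'. complex_of_real (h ((1 - \<theta>) * of_int n
            + (b + (of_int m - (1 - \<theta>) * of_int k)) - of_int n')) * fst \<psi> (n' - m)) =
        (\<Sum>\<^sub>\<infinity>n'. complex_of_real (h ((1 - \<theta>) * of_int (n - k) + b - of_int n')) * fst \<psi> n')" for n
    using infsum_reindex_bij_betw[OF bij_int_diff,
        of "\<lambda>n'. complex_of_real (h ((1 - \<theta>) * of_int (n - k) + b - of_int n')) * fst \<psi> n'" m]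
    by (simp add: algebra_simps)
  ultimately show ?thesis
    by (simp add: coupled_chain_def chain_translate_def discrete_laplacian_def algebra_simps)
qed

section \<open>Spectral stability under change of the offset\<close>

context
  fixes h :: "real \<Rightarrow> real" and \<theta> C c :: real
  assumes \<theta>: "\<theta> < 1" and c: "c > 0"
    and decay: "\<And>y. \<bar>h y\<bar> \<le> C * exp (- c * \<bar>y\<bar>)"
begin

lemma schur_bounded_chain_kernel: "\<exists>M. \<forall>b. schur_bounded (chain_kernel h \<theta> b) M"
proof -
  have "schur_bounded (hopping_kernel h (1 - \<theta>) b) (C * (lattice_bound c (1 - \<theta>) + lattice_bound c 1))"
    "schur_bounded (hopping_kernel (\<lambda>y. h (- y)) (1 - \<theta>) b)
      (C * (lattice_bound c (1 - \<theta>) + lattice_bound c 1))" for b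
    using \<theta> c schur_bounded_hopping_kernel[OF decay] decay[of "- y" for y, unfolded abs_minus_cancel]
      schur_bounded_hopping_kernel[of "\<lambda>y. h (- y)" C c "1 - \<theta>" b]
    by auto
  then show ?thesis
    unfolding chain_kernel_def
    by (blast intro: schur_bounded_block_kernel[OF schur_bounded_laplace_kernel _ schur_bounded_transpose
        schur_bounded_laplace_kernel])
qed

lemma flatten_coupled_chain:
  assumes \<psi>: "\<psi> \<in> ell2_sum"
  shows "flatten (coupled_chain h \<theta> b \<psi>) = kernel_op (chain_kernel h \<theta> b) (flatten \<psi>)"
proof
  fix i
  obtain M where M: "schur_bounded (chain_kernel h \<theta> b) M" using schur_bounded_chain_kernel by blast
  have "kernel_op (chain_kernel h \<theta> b) (flatten \<psi>) i =
      (\<Sum>\<^sub>\<infinity>n'. chain_kernel h \<theta> b i (Inl n') * fst \<psi> n') + (\<Sum>\<^sub>\<infinity>n'. chain_kernel h \<theta> b i (Inr n') * snd \<psi> n')"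
    using infsum_sum_type[OF kernel_row_summable[OF M, of "flatten \<psi>" i]] \<psi>
    by (simp add: kernel_op_def ell2_sum_iff)
  moreover have "hopping_kernel (\<lambda>y. h (- y)) (1 - \<theta>) b n' n =
      complex_of_real (h ((1 - \<theta>) * of_int n + b - of_int n'))" for n n'
    by (simp add: hopping_kernel_def algebra_simps)
  ultimately show "flatten (coupled_chain h \<theta> b \<psi>) i = kernel_op (chain_kernel h \<theta> b) (flatten \<psi>) i"
    by (cases i)
       (simp_all add: chain_kernel_def laplace_kernel_infsum coupled_chain_def add.commute,
        simp add: hopping_kernel_def)
qed

lemma coupled_chain_linear: "chain_linear (coupled_chain h \<theta> b)"
proof -
  obtain M where M: "schur_bounded (chain_kernel h \<theta> b) M" using schur_bounded_chain_kernel by blast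
  show ?thesis
    unfolding chain_linear_def
    by (auto simp: ell2_sum_iff flatten_coupled_chain ell2_sum_cscale ell2_sum_add flatten_add flatten_cscale
        kernel_op_l2[OF M] kernel_op_add[OF M] kernel_op_cmult l2_add l2_cmult
        simp flip: flatten_inject)
qed

lemma coupled_chain_bounded:
  obtains M where "M \<ge> 0" "\<And>b \<psi>. \<psi> \<in> ell2_sum \<Longrightarrow> ell2_sum_norm (coupled_chain h \<theta> b \<psi>) \<le> M * ell2_sum_norm \<psi>"
proof -
  obtain M where M: "\<And>b. schur_bounded (chain_kernel h \<theta> b) M" using schur_bounded_chain_kernel by blast
  show thesis
  proof (rule that[of M])
    show "M \<ge> 0" using M by (auto simp: schur_bounded_def)
    fix b and \<psi> :: chain_state assume "\<psi> \<in> ell2_sum"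
    then show "ell2_sum_norm (coupled_chain h \<theta> b \<psi>) \<le> M * ell2_sum_norm \<psi>"
      using coupled_chain_linear[of b] l2_norm_kernel_op[OF M, of "flatten \<psi>" b]
      by (simp add: chain_linear_def ell2_sum_norm_eq flatten_coupled_chain) (simp add: ell2_sum_iff)
  qed
qed

text \<open>The Laplacian blocks cancel in the difference, leaving hopping kernels of h(y) - h(y -
  t) with t = b' - b. The estimate depends on t alone, so \<delta> is uniform in the
  offsets.\<close>

lemma coupled_chain_norm_continuous:
  assumes cont: "continuous_on UNIV h" and e: "e > 0"
  obtains \<delta> where "\<delta> > 0" "\<And>b b' \<psi>. \<bar>b' - b\<bar> < \<delta> \<Longrightarrow> \<psi> \<in> ell2_sum \<Longrightarrow>
    ell2_sum_norm (coupled_chain h \<theta> b \<psi> - coupled_chain h \<theta> b' \<psi>) \<le> e * ell2_sum_norm \<psi>"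
proof -
  define B where "B = lattice_bound (c / 2) (1 - \<theta>) + lattice_bound (c / 2) 1"
  have B: "0 \<le> B" using c \<theta> by (simp add: B_def lattice_bound_nonneg)
  \<comment> \<open>Each of the two hopping blocks contributes e'B; the summand 1 keeps the
    denominator positive and the total 2e'B below \<open>e\<close>.\<close>
  define e' where "e' = e / (2 * B + 1)"
  have "e' > 0" using e B by (simp add: e'_def)
  have e'_eq: "e' * (2 * B + 1) = e" using B by (simp add: e'_def)
  obtain \<delta> where \<delta>: "\<delta> > 0"
    and mod: "\<And>t y. \<bar>t\<bar> < \<delta> \<Longrightarrow> \<bar>h y - h (y - t)\<bar> \<le> e' * exp (- (c / 2) * \<bar>y\<bar>)"
    using exp_decay_modulus[OF cont c decay \<open>e' > 0\<close>] by blast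
  show thesis
  proof (rule that[OF \<delta>])
    fix b b' and \<psi> :: chain_state assume bb: "\<bar>b' - b\<bar> < \<delta>" and \<psi>: "\<psi> \<in> ell2_sum"
    define t where "t = b' - b"
    define k where "k = (\<lambda>i j. chain_kernel h \<theta> b i j - chain_kernel h \<theta> b' i j)"
    \<comment> \<open>In the lower left block the argument of h is reflected, so the same change of
      offset acts as a shift by -t.\<close>
    have k_eq: "k = block_kernel (\<lambda>_ _. 0) (hopping_kernel (\<lambda>y. h y - h (y - t)) (1 - \<theta>) b)
       (\<lambda>n n'. hopping_kernel (\<lambda>y. h (- y) - h (- y - (- t))) (1 - \<theta>) b n' n) (\<lambda>_ _. 0)"
    proof (intro ext)
      fix i j
      show "k i j = block_kernel (\<lambda>_ _. 0) (hopping_kernel (\<lambda>y. h y - h (y - t)) (1 - \<theta>) b)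
       (\<lambda>n n'. hopping_kernel (\<lambda>y. h (- y) - h (- y - (- t))) (1 - \<theta>) b n' n) (\<lambda>_ _. 0) i j"
        by (cases i; cases j) (auto simp: k_def chain_kernel_def hopping_kernel_def t_def algebra_simps)
    qed
    have mod': "\<bar>h y - h (y - t)\<bar> \<le> e' * exp (- (c / 2) * \<bar>y\<bar>)"
      "\<bar>h (- y) - h (- y - (- t))\<bar> \<le> e' * exp (- (c / 2) * \<bar>y\<bar>)" for y
      using mod[of t y] mod[of "- t" "- y"] bb by (simp_all add: t_def)
    have "schur_bounded (hopping_kernel (\<lambda>y. h y - h (y - t)) (1 - \<theta>) b) (e' * B)"
      "schur_bounded (hopping_kernel (\<lambda>y. h (- y) - h (- y - (- t))) (1 - \<theta>) b) (e' * B)"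
      unfolding B_def
      by (rule schur_bounded_hopping_kernel[OF mod'(1)] schur_bounded_hopping_kernel[OF mod'(2)];
          use \<theta> c in simp)+
    then have "schur_bounded k (0 + e' * B + e' * B + 0)"
      unfolding k_eq
      by (intro schur_bounded_block_kernel schur_bounded_transpose[of "hopping_kernel g \<alpha> d" for g \<alpha> d])
         (auto simp: schur_bounded_def[of "\<lambda>_ _. 0"])
    then have "l2_norm (kernel_op k (flatten \<psi>)) \<le> (0 + e' * B + e' * B + 0) * l2_norm (flatten \<psi>)"
      using \<psi> by (intro l2_norm_kernel_op) (auto simp: ell2_sum_iff)
    also have "\<dots> \<le> e * l2_norm (flatten \<psi>)"
      using e'_eq \<open>e' > 0\<close> by (intro mult_right_mono) (auto simp: algebra_simps)
    also have "kernel_op k (flatten \<psi>) = flatten (coupled_chain h \<theta> b \<psi> - coupled_chain h \<theta> b' \<psi>)"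
    proof -
      obtain M where M: "\<And>b. schur_bounded (chain_kernel h \<theta> b) M" using schur_bounded_chain_kernel by blast
      show ?thesis
        unfolding k_def using \<psi> kernel_op_diff[OF M M]
        by (simp add: flatten_diff flatten_coupled_chain) (simp add: ell2_sum_iff)
    qed
    finally show "ell2_sum_norm (coupled_chain h \<theta> b \<psi> - coupled_chain h \<theta> b' \<psi>) \<le> e * ell2_sum_norm \<psi>"
      using \<psi> coupled_chain_linear[of b] coupled_chain_linear[of b']
      by (simp add: ell2_sum_norm_eq ell2_sum_diff chain_linear_def)
  qed
qed

section \<open>Reality of the spectrum\<close>

lemma coupled_chain_lower_bound:
  assumes "even_function h" and \<psi>: "\<psi> \<in> ell2_sum"
  shows "\<bar>Im z\<bar> * ell2_sum_norm \<psi> \<le> ell2_sum_norm (coupled_chain h \<theta> b \<psi> - cscale z \<psi>)"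
proof -
  obtain M where M: "schur_bounded (chain_kernel h \<theta> b) M" using schur_bounded_chain_kernel by blast
  have "coupled_chain h \<theta> b \<psi> - cscale z \<psi> \<in> ell2_sum"
    using \<psi> coupled_chain_linear[of b] by (simp add: chain_linear_def ell2_sum_diff ell2_sum_cscale)
  moreover have "flatten (coupled_chain h \<theta> b \<psi> - cscale z \<psi>) =
      (\<lambda>i. kernel_op (chain_kernel h \<theta> b) (flatten \<psi>) i - z * flatten \<psi> i)"
    using \<psi> by (simp add: flatten_diff flatten_coupled_chain flatten_cscale fun_eq_iff)
  ultimately show ?thesis
    using hermitian_kernel_lower_bound[OF M chain_kernel_hermitian[OF assms(1)], of "flatten \<psi>" z] \<psi>
    by (simp add: ell2_sum_norm_eq) (simp add: ell2_sum_iff)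
qed

text \<open>H(b) - z is viewed as a perturbation of multiplication by -z, of size at most
  \<open>M\<close>. This supplies the initial surjectivity from which the nonreal points are
  reached.\<close>

lemma expanding_onto_coupled_chain_far:
  assumes bound: "\<And>\<psi>. \<psi> \<in> ell2_sum \<Longrightarrow> ell2_sum_norm (coupled_chain h \<theta> b \<psi>) \<le> M * ell2_sum_norm \<psi>"
    and "0 \<le> M" "M < cmod z"
  shows "expanding_onto (cmod z - M) (\<lambda>\<psi>. coupled_chain h \<theta> b \<psi> - cscale z \<psi>)"
proof (rule expanding_onto_perturb[where ?S0.0 = "\<lambda>\<psi>. cscale (- z) \<psi>"])
  have "z \<noteq> 0" using assms by auto
  show "chain_linear (cscale (- z))"
    by (simp add: chain_linear_def ell2_sum_cscale cscale_add cscale_cscale mult.commute)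
  show "expanding_onto (cmod z) (cscale (- z))"
    unfolding expanding_onto_def
  proof (intro conjI ballI subset_antisym subsetI)
    fix \<psi> assume "\<psi> \<in> ell2_sum"
    then have "cscale (- 1 / z) \<psi> \<in> ell2_sum" "\<psi> = cscale (- z) (cscale (- 1 / z) \<psi>)"
      using \<open>z \<noteq> 0\<close> by (auto simp: ell2_sum_cscale cscale_cscale cscale_1)
    then show "\<psi> \<in> cscale (- z) ` ell2_sum" by blast
  qed (auto simp: ell2_sum_cscale ell2_sum_norm_cscale)
  fix \<psi> :: chain_state assume \<psi>: "\<psi> \<in> ell2_sum"
  have "cscale (- z) \<psi> - (coupled_chain h \<theta> b \<psi> - cscale z \<psi>) = cscale (- 1) (coupled_chain h \<theta> b \<psi>)"
    by (auto simp: cscale_def prod_eq_iff fun_eq_iff)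
  then show "ell2_sum_norm (cscale (- z) \<psi> - (coupled_chain h \<theta> b \<psi> - cscale z \<psi>)) \<le> M * ell2_sum_norm \<psi>"
    using bound[OF \<psi>] coupled_chain_linear[of b] \<psi> by (simp add: ell2_sum_norm_cscale chain_linear_def)
qed (use assms coupled_chain_linear in \<open>auto intro: chain_linear_shift\<close>)

text \<open>
  The lower bound \<open>\<bar>Im w\<bar>\<close> makes the disc of radius \<open>\<bar>Im w\<bar>\<close> around a point \<open>w\<close> of the resolvent set
  free of spectrum; for \<open>Im w\<close> large, these discs exhaust a half plane. This avoids any use of
  orthogonal complements.
\<close>

lemma coupled_chain_spectrum_real:
  assumes even: "even_function h"
  shows "spectrum (coupled_chain h \<theta> b) \<subseteq> \<real>"
proof (rule subsetI, rule ccontr)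
  fix z assume z: "z \<in> spectrum (coupled_chain h \<theta> b)" "z \<notin> \<real>"
  then have Im: "Im z \<noteq> 0" by (simp add: complex_is_Real_iff)
  obtain M where M: "M \<ge> 0" "\<And>b \<psi>. \<psi> \<in> ell2_sum \<Longrightarrow> ell2_sum_norm (coupled_chain h \<theta> b \<psi>) \<le> M * ell2_sum_norm \<psi>"
    using coupled_chain_bounded by metis
  \<comment> \<open>Moves z away from the real axis by M + 1. That is enough for |w| > M, while the
    distance M + 1 back to z stays below |Im w| because Im z is nonzero.\<close>
  define w where "w = z + \<i> * of_real (sgn (Im z) * (M + 1))"
  have absw: "\<bar>Im w\<bar> = \<bar>Im z\<bar> + (M + 1)"
    using M(1) Im by (cases "Im z" "0 :: real" rule: linorder_cases) (auto simp: w_def)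
  have dist: "cmod (z - w) = M + 1"
    using M(1) Im by (simp add: w_def norm_mult abs_mult abs_sgn_eq)
  have "M < cmod w" using absw abs_Im_le_cmod[of w] by linarith
  then have "expanding_onto (cmod w - M) (\<lambda>\<psi>. coupled_chain h \<theta> b \<psi> - cscale w \<psi>)"
    using M by (intro expanding_onto_coupled_chain_far) auto
  \<comment> \<open>Only surjectivity is kept from the previous fact. Its constant |w| - M may be
    smaller than the distance M + 1 to z, whereas |Im w| exceeds it.\<close>
  then have w: "expanding_onto \<bar>Im w\<bar> (\<lambda>\<psi>. coupled_chain h \<theta> b \<psi> - cscale w \<psi>)"
    using coupled_chain_lower_bound[OF even] by (auto simp: expanding_onto_def)
  have "expanding_onto (\<bar>Im w\<bar> - (M + 1)) (\<lambda>\<psi>. coupled_chain h \<theta> b \<psi> - cscale z \<psi>)"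
  proof (rule expanding_onto_perturb[OF _ _ w])
    fix \<psi> :: chain_state assume "\<psi> \<in> ell2_sum"
    then show "ell2_sum_norm (coupled_chain h \<theta> b \<psi> - cscale w \<psi> - (coupled_chain h \<theta> b \<psi> - cscale z \<psi>))
      \<le> (M + 1) * ell2_sum_norm \<psi>"
      by (simp add: dist ell2_sum_norm_cscale flip: cscale_diff_left)
  qed (use absw Im M(1) coupled_chain_linear in \<open>auto intro: chain_linear_shift\<close>)
  then have "z \<in> resolvent_set (coupled_chain h \<theta> b)"
    using absw Im
    by (auto simp: resolvent_set_iff[OF coupled_chain_linear] intro!: exI[of _ "\<bar>Im z\<bar>"])
  with z show False by (simp add: spectrum_def)
qed

section \<open>Transport of the resolvent set along translation orbits\<close>

lemma resolvent_set_translate: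
  assumes "z \<in> resolvent_set (coupled_chain h \<theta> b)"
  shows "z \<in> resolvent_set (coupled_chain h \<theta> (b + (of_int m - (1 - \<theta>) * of_int k)))"
proof -
  define b' where "b' = b + (of_int m - (1 - \<theta>) * of_int k)"
  define U where "U = chain_translate m k"
  have U: "U \<psi> \<in> ell2_sum" if "\<psi> \<in> ell2_sum" for \<psi> using that by (simp add: U_def chain_translate_ell2_sum)
  have intertwine: "coupled_chain h \<theta> b' (U \<psi>) - cscale z (U \<psi>) = U (coupled_chain h \<theta> b \<psi> - cscale z \<psi>)" for \<psi>
    unfolding b'_def U_def coupled_chain_translate
    by (simp add: chain_translate_def cscale_def prod_eq_iff fun_eq_iff)
  have surj: "\<exists>\<phi>\<in>ell2_sum. \<psi> = U \<phi>" if "\<psi> \<in> ell2_sum" for \<psi>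
    using that chain_translate_ell2_sum[of \<psi> "- m" "- k"] chain_translate_inverse[of m k \<psi>] unfolding U_def by metis
  obtain e where e: "e > 0" and ex: "expanding_onto e (\<lambda>\<psi>. coupled_chain h \<theta> b \<psi> - cscale z \<psi>)"
    using assms by (auto simp: resolvent_set_iff[OF coupled_chain_linear])
  have "expanding_onto e (\<lambda>\<psi>. coupled_chain h \<theta> b' \<psi> - cscale z \<psi>)"
    unfolding expanding_onto_def
  proof (intro conjI ballI subset_antisym subsetI)
    fix \<psi> assume "\<psi> \<in> ell2_sum"
    then obtain \<phi> where \<phi>: "\<phi> \<in> ell2_sum" "\<psi> = U \<phi>" using surj by blast
    then show "e * ell2_sum_norm \<psi> \<le> ell2_sum_norm (coupled_chain h \<theta> b' \<psi> - cscale z \<psi>)"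
      using ex by (simp add: intertwine expanding_onto_def) (simp add: U_def ell2_sum_norm_chain_translate)
    obtain \<xi> where "\<xi> \<in> ell2_sum" "\<phi> = coupled_chain h \<theta> b \<xi> - cscale z \<xi>"
      using ex \<phi>(1) unfolding expanding_onto_def by blast
    then show "\<psi> \<in> (\<lambda>\<psi>. coupled_chain h \<theta> b' \<psi> - cscale z \<psi>) ` ell2_sum"
      using \<phi>(2) U[of \<xi>] by (intro image_eqI[of _ _ "U \<xi>"]) (auto simp: intertwine)
  next
    fix \<psi> assume "\<psi> \<in> (\<lambda>\<psi>. coupled_chain h \<theta> b' \<psi> - cscale z \<psi>) ` ell2_sum"
    then show "\<psi> \<in> ell2_sum"
      using chain_linear_shift[OF coupled_chain_linear[of b'], of z] by (auto simp: chain_linear_def)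
  qed
  then show ?thesis
    using e by (auto simp: resolvent_set_iff[OF coupled_chain_linear] b'_def)
qed

lemma resolvent_set_subset:
  assumes cont: "continuous_on UNIV h" and irrat: "1 - \<theta> \<notin> \<rat>"
  shows "resolvent_set (coupled_chain h \<theta> b) \<subseteq> resolvent_set (coupled_chain h \<theta> b')"
proof
  fix z assume "z \<in> resolvent_set (coupled_chain h \<theta> b)"
  then obtain e where e: "e > 0" and ex: "expanding_onto e (\<lambda>\<psi>. coupled_chain h \<theta> b \<psi> - cscale z \<psi>)"
    by (auto simp: resolvent_set_iff[OF coupled_chain_linear])
  \<comment> \<open>Uniformity of \<delta> in the offsets matters: it is fixed before b'' is known.
    The choice e/2 leaves half of the lower bound.\<close>
  obtain \<delta> where \<delta>: "\<delta> > 0" and close: "\<And>b b' \<psi>. \<bar>b' - b\<bar> < \<delta> \<Longrightarrow> \<psi> \<in> ell2_sum \<Longrightarrow>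
      ell2_sum_norm (coupled_chain h \<theta> b \<psi> - coupled_chain h \<theta> b' \<psi>) \<le> e / 2 * ell2_sum_norm \<psi>"
    using coupled_chain_norm_continuous[OF cont, of "e / 2"] e by (metis half_gt_zero)
  obtain m k :: int where mk: "\<bar>of_int m - (1 - \<theta>) * of_int k - (b - b')\<bar> < \<delta>"
    using Kronecker_dense[OF irrat \<delta>] by blast
  define b'' where "b'' = b' + (of_int m - (1 - \<theta>) * of_int k)"
  have "\<bar>b'' - b\<bar> < \<delta>" using mk by (simp add: b''_def algebra_simps)
  then have "expanding_onto (e - e / 2) (\<lambda>\<psi>. coupled_chain h \<theta> b'' \<psi> - cscale z \<psi>)"
    using close[of b'' b] e
    by (intro expanding_onto_perturb[OF _ _ ex]) (auto intro: chain_linear_shift coupled_chain_linear)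
  then have "z \<in> resolvent_set (coupled_chain h \<theta> b'')"
    using e by (auto simp: resolvent_set_iff[OF coupled_chain_linear] intro!: exI[of _ "e - e / 2"])
  then have "z \<in> resolvent_set (coupled_chain h \<theta> (b'' + (of_int (- m) - (1 - \<theta>) * of_int (- k))))"
    by (rule resolvent_set_translate)
  then show "z \<in> resolvent_set (coupled_chain h \<theta> b')"
    by (simp add: b''_def)
qed

lemma coupled_chain_spectrum_constant:
  assumes "continuous_on UNIV h" "1 - \<theta> \<notin> \<rat>" "even_function h"
  shows "\<exists>S. \<forall>b. spectrum (coupled_chain h \<theta> b) = complex_of_real ` S"
proof (intro exI allI)
  fix b
  have "spectrum (coupled_chain h \<theta> b) = spectrum (coupled_chain h \<theta> 0)"
    using resolvent_set_subset[OF assms(1,2)] unfolding spectrum_def by blast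
  \<comment> \<open>The witness consists of the real points of the spectrum at offset 0; since that
    spectrum is real, its image is the whole of it.\<close>
  also have "\<dots> = complex_of_real ` {x. complex_of_real x \<in> spectrum (coupled_chain h \<theta> 0)}"
    using coupled_chain_spectrum_real[OF assms(3), of 0] by (auto simp: Reals_def)
  finally show "spectrum (coupled_chain h \<theta> b) =
      complex_of_real ` {x. complex_of_real x \<in> spectrum (coupled_chain h \<theta> 0)}" .
qed

end

theorem theorem3p16:
  fixes \<theta> :: real and h :: "real \<Rightarrow> real"
  assumes "0 < \<theta>" and "\<theta> < 1" and "\<theta> \<notin> \<rat>"
    and "even_function h" and "smooth_function h" and "exponentially_decaying h"
  shows "\<exists>S :: real set. AE b in lebesgue. spectrum (coupled_chain h \<theta> b) = complex_of_real ` S"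
proof -
  obtain C c where c: "c > 0" and decay: "\<And>y. \<bar>h y\<bar> \<le> C * exp (- c * \<bar>y\<bar>)"
    using assms(6) unfolding exponentially_decaying_def by blast
  have "h differentiable (at x)" for x
    using assms(5)[unfolded smooth_function_def, rule_format, of 0] by simp
  then have cont: "continuous_on UNIV h"
    by (simp add: continuous_at_imp_continuous_on differentiable_imp_continuous_within)
  have irrat: "1 - \<theta> \<notin> \<rat>"
    using assms(3) Rats_diff[OF Rats_1, of "1 - \<theta>"] by auto
  obtain S where "spectrum (coupled_chain h \<theta> b) = complex_of_real ` S" for b
    using coupled_chain_spectrum_constant[OF assms(2) c decay cont irrat assms(4)] by blast
  then show ?thesis by (intro exI[of _ S] AE_I2)
qed

end
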